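(* Let $\phi$ be a normalized bound-linear schema, and let $\phi{\downarrow}_\tau$ denote a normal form of $\phi$ with respect to the rewrite system $\tau=\{\tau_1,\tau_2,\tau_3,\tau_3',\tau_4,\tau_4',\tau_5,\dots,\tau_{10}\}$ defined in the context. Then $\phi$ is satisfiable if and only if $\phi{\downarrow}_\tau$ is satisfiable.
   Context: **Schemata.** Fix countably infinite sets of arithmetic variables and of propositional symbols $\mathcal P$. Linear arithmetic expressions are built from arithmetic variables and $0,s,+,-$, modulo the usual arithmetic laws. An indexed proposition is $p_a$ with $p\in\mathcal P$ and $a$ a linear arithmetic expression (its index); if $a\in\mathbb Z$ it is a propositional variable. Schemata form the smallest set such that: $\top,\bot$, every $a<b$ (arithmetic atom; $a,b$ linear arithmetic expressions) and every indexed proposition are schemata; $\phi_1\vee\phi_2$, $\phi_1\wedge\phi_2$, $\neg\phi_1$ are schemata if $\phi_1,\phi_2$ are; if $\phi$ is a schema not containing $<$, $i$ is an arithmetic variable and $a,b$ are linear arithmetic expressions, then $\bigwedge_{i=a}^b\phi$ and $\bigvee_{i=a}^b\phi$ are schemata (iterations with bounds $a,b$). The symbols $\Rightarrow,\Leftrightarrow,\le,\ge,>,=$ are the usual abbreviations. A variable $i$ is bound in $\phi$ if $\phi$ contains an iteration over $i$; it is free (a parameter) if it occurs outside the scope of every iteration over $i$. No variable is both free and bound in a schema, and distinct iterations use distinct variables (bound variables are renamed when needed). $\phi[x/y]$ denotes the replacement of $y$ by $x$ in $\phi$. **Semantics.** An interpretation $\mathcal I$ maps arithmetic variables to integers and propositional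 variables to truth values; $[\![a]\!]_{\mathcal I}$ is the integer value of $a$. $a<b$ is true iff $[\![a]\!]_{\mathcal I}<[\![b]\!]_{\mathcal I}$; $p_a$ has the value $\mathcal I(p_{[\![a]\!]_{\mathcal I}})$; connectives are as usual; $\bigvee_{i=a}^b\phi$ (resp. $\bigwedge_{i=a}^b\phi$) is true in $\mathcal I$ iff $\phi$ is true in $\mathcal I[\alpha/i]$ for some (resp. every) integer $\alpha$ with $[\![a]\!]_{\mathcal I}\le\alpha\le[\![b]\!]_{\mathcal I}$. Parameters are always interpreted by natural numbers. A schema is satisfiable iff it is true in some such interpretation. **Bound-linear, normalized.** $\phi$ is bound-linear iff (1) it contains at most one free arithmetic variable $n$; (2) every non-arithmetic atom other than $\top,\bot$ is of the form $p_{\alpha n+\beta i+\gamma}$ with $i$ a bound variable, $\alpha,\gamma\in\mathbb Z$, $\beta\in\{-1,0,1\}$; (3) the lower and upper bounds of every iteration are respectively of the form $\alpha n+\beta$ and $\gamma n+\delta+\epsilon j$ with $\alpha,\beta,\gamma,\delta\in\mathbb Z$, $\epsilon\in\{-1,0,1\}$, $j$ a bound variable. It is normalized if moreover the coefficient of $n$ is even in every index and every iteration bound. **Notation.** $n$ is the parameter. $\Pi,\Gamma$ stand for $\bigvee$ or $\bigwedge$. For an iteration connective $\Pi$: if $\Pi=\bigvee$ then $\diamond=\bot$, $\star=\vee$; if $\Pi=\bigwedge$ then $\diamond=\top$, $\star=\wedge$. For a variable $i$, $\mathcal N_i$ is the set of expressions $i+\beta$, $\beta\in\mathbb Z$. $[\psi]_{n\mapsto\kappa}$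 is the propositional formula obtained from $\psi$ by replacing $n$ by $\kappa\in\mathbb N$ and fully unfolding all iterations (an empty $\bigvee$ being $\bot$, an empty $\bigwedge$ being $\top$). The expressions $\min_\phi,\max_\phi$ are defined by: $\min_\phi(a)=\max_\phi(a)=a$ if $a$ is an integer or a free variable of $\phi$; $\min_\phi(b+c)=\min_\phi(b)+\min_\phi(c)$ and likewise for $\max_\phi$; $\max_\phi(-b)=-\min_\phi(b)$, $\min_\phi(-b)=-\max_\phi(b)$; if $i$ is the variable of an iteration $\Pi_{i=a}^b$ of $\phi$, then $\min_\phi(i)=\min_\phi(a)$, $\max_\phi(i)=\max_\phi(b)$. **The rewrite system $\tau$.** The rules must be applied in the order of their presentation. In $\tau_2,\tau_3,\tau_3',\tau_4,\tau_4',\tau_6,\tau_7,\tau_9$ the left-hand side is the whole schema; the other rules rewrite an iteration occurring in the schema. - $\tau_1$: $\Pi_{i=a}^b\phi\to(p_e\wedge\Pi_{i=a}^b\phi[\top/p_e])\vee(\neg p_e\wedge\Pi_{i=a}^b\phi[\bot/p_e])$, if $p_e$ occurs in $\phi$, the variables of $e$ are free in $\Pi_{i=a}^b\phi$, and for every iteration $\Gamma_{j=c}^d\phi'$ containing $\Pi_{i=a}^b\phi$, $p_e$ contains $j$ or a variable bound in $\Gamma_{j=c}^d\phi'$. - $\tau_2$: $\psi\to(p\Leftrightarrow\Pi_{i=a}^b\phi)\wedge\psi[p/\Pi_{i=a}^b\phi]$, if $p$ is fresh (a proposition with a fixed constant index), and $\Pi_{i=a}^b\phi$ occurs inside an iteration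 of $\psi$ and contains no free variable except $n$. In the next four rules $p$ is a fresh symbol, the displayed iteration over $i$ occurs inside an iteration of $\phi$, $j$ is bound in $\phi$, $a,b$ contain no variable except $n$, and $\psi$ contains no free variable except $n$ and $i$. - $\tau_3$: $\phi\to\neg p_{a-b-1}\wedge\bigwedge_{j=\min_\phi(j)}^{a-b-1}\neg p_j\wedge\bigwedge_{j=a-b}^{\max_\phi(j)}(p_j\Leftrightarrow(p_{j-1}\vee\psi[b+j/i]))\wedge\phi[p_j/\bigvee_{i=a}^{b+j}\psi]$. - $\tau_3'$: $\phi\to p_{a-b-1}\wedge\bigwedge_{j=\min_\phi(j)}^{a-b-1}p_j\wedge\bigwedge_{j=a-b}^{\max_\phi(j)}(p_j\Leftrightarrow(p_{j-1}\wedge\psi[b+j/i]))\wedge\phi[p_j/\bigwedge_{i=a}^{b+j}\psi]$. - $\tau_4$: $\phi\to\neg p_{b-a+1}\wedge\bigwedge_{j=b-a+1}^{\max_\phi(j)}\neg p_j\wedge\bigwedge_{j=\min_\phi(j)}^{b-a}(p_j\Leftrightarrow(p_{j+1}\vee\psi[b-j/i]))\wedge\phi[p_j/\bigvee_{i=a}^{b-j}\psi]$. - $\tau_4'$: $\phi\to p_{b-a+1}\wedge\bigwedge_{j=b-a+1}^{\max_\phi(j)}p_j\wedge\bigwedge_{j=\min_\phi(j)}^{b-a}(p_j\Leftrightarrow(p_{j+1}\wedge\psi[b-j/i]))\wedge\phi[p_j/\bigwedge_{i=a}^{b-j}\psi]$. - $\tau_5$: $\Pi_{i=\alpha n+\beta}^{\gamma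 n-\delta}\phi\to\Pi_{i=\beta}^{(\gamma-\alpha)n-\delta}\phi[i+\alpha n/i]$, if $\alpha\neq0$, $\beta\in\mathbb Z$. - $\tau_6$: $\psi\to[\psi]_{n\mapsto0}\vee\dots\vee[\psi]_{n\mapsto\kappa}\vee(n>\kappa\wedge\psi[\diamond/\Pi_{i=\gamma}^{\alpha n-\beta}\phi])$, if $\psi$ contains $\Pi_{i=\gamma}^{\alpha n-\beta}\phi$ with $\alpha,\beta,\gamma\in\mathbb Z$, $\alpha<0$, where $\kappa=\lceil\frac{\gamma+\beta}{\alpha}\rceil$. - $\tau_7$: $\psi\to((\alpha-1)n-\beta\ge\gamma\wedge\psi[\psi'/\Pi_{i=\gamma}^{\alpha n-\beta}\phi])\vee([\psi]_{n\mapsto0}\vee\dots\vee[\psi]_{n\mapsto\kappa})$, if $\psi$ contains $\Pi_{i=\gamma}^{\alpha n-\beta}\phi$ with $\alpha>1$, where $\psi'$ is $\Pi_{i=\gamma}^{(\alpha-1)n-\beta}\phi\star\Pi_{i=1}^n\phi[i+(\alpha-1)n-\beta/i]$ and $\kappa=\lfloor\frac{\gamma+\beta}{\alpha-1}\rfloor$. (In $\tau_6,\tau_7$, if $\kappa<0$ there are no disjuncts $[\psi]_{n\mapsto\cdot}$.) - $\tau_8$: $\Pi_{i=\gamma}^{n-\beta}\phi\to\Pi_{i=\beta}^{n-\gamma}\phi[n-i/i]$, if the indices of the variables in $\phi$ are all of the form $(2\alpha+1)n+c$ with $\alpha\in\mathbb Z$ and $c$ not containing $n$. - $\tau_9$: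 $\phi\to\overline\phi\wedge\bigwedge_{\psi\in\Psi(\phi)}\psi$, if $\phi$ contains a propositional symbol not in $V^+\cup V^-$ (see below). - $\tau_{10}$: $\Pi_{i=\alpha}^{n-\beta}\phi\to(n<\alpha+\beta\wedge\diamond)\vee\big(n\ge\alpha+\beta\wedge(\Pi_{i=\alpha'}^{n-\beta-1+\alpha'-\alpha}\phi[i-\alpha'+\alpha/i]\star\phi[n-\beta/i])\big)$, where $\alpha'$ is the maximal lower bound and $n-\beta'$ the minimal upper bound of the iterations occurring in the whole formula, and $\alpha\neq\alpha'$ or $\beta\neq\beta'$. **Objects used in $\tau_9$.** $V^+,V^-$ are disjoint sets of fresh propositional symbols; each pair $(p,\alpha)$ of a symbol $p$ of the formula and an integer $\alpha$ is mapped to symbols $\overline p^{\alpha^+}\in V^+$ and $\overline p^{\alpha^-}\in V^-$. $\overline\phi$ is obtained from $\phi$ by replacing every atom $p_{2\alpha n+a}$ by $\overline p^{\alpha^+}_a$ and every atom $p_{2\alpha n-a}$ by $\overline p^{\alpha^-}_a$, where $a\in\mathcal N_i\cup\mathbb N$ for some bound variable $i$ (possibly $\alpha=0$; if $a=0$ either choice is allowed). $\Psi$ is the set of all schemata $2\alpha n+a=2\beta n-b\Rightarrow(\overline p_a^{\alpha^+}\Leftrightarrow\overline p_b^{\beta^-})$, $2\alpha n+a=2\beta n+b\Rightarrow(\overline p_a^{\alpha^+}\Leftrightarrow\overline p_b^{\beta^+})$ and $2\alpha n-a=2\beta n-b\Rightarrow(\overline p_a^{\alpha^-}\Leftrightarrow\overline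 p_b^{\beta^-})$ with $\alpha,\beta\in\mathbb Z$ and $a,b\in\mathcal N_n\cup\mathbb Z$. An element $\chi\Rightarrow(u\Leftrightarrow v)$ of $\Psi$ is relevant w.r.t. $\phi$ iff $u,v$ are not syntactically identical and there is $\kappa\in\mathbb N$ such that $\chi[\kappa/n]$ is true and $[\overline\phi]_{n\mapsto\kappa}$ contains both $u[\kappa/n]$ and $v[\kappa/n]$. $\Psi(\phi)$ denotes a finite subset of $\Psi$ containing all relevant formulae up to equivalence (formulae being compared after $n$ is replaced by its value). For instance, if $\iota$ is the greatest natural number occurring in $\phi$ (possibly as a coefficient or in $-\iota$), one may take all elements of $\Psi$, for the symbols $p$ of $\phi$, with $\alpha,\beta\in[-\iota,\iota]$ and $a,b\in[-2\iota,6\iota]\cup\{n+\gamma:\gamma\in[-2\iota,2\iota]\}$. *)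

theory Defs
  imports Complex_Main "HOL-Library.Poly_Mapping"
begin

section \<open>Syntax\<close>

type_synonym avar = nat

text \<open>Linear arithmetic expressions modulo the usual arithmetic laws, i.e. in normal form:
  the coefficient of a variable \<open>v\<close> is stored at \<open>Some v\<close>, the constant term at \<open>None\<close>.\<close>

type_synonym lexp = "avar option \<Rightarrow>\<^sub>0 int"

definition cst :: "int \<Rightarrow> lexp" where
  "cst k = Poly_Mapping.single None k"

definition mon :: "int \<Rightarrow> avar \<Rightarrow> lexp" where
  "mon k v = Poly_Mapping.single (Some v) k"

definition coef :: "lexp \<Rightarrow> avar \<Rightarrow> int" where
  "coef e v = Poly_Mapping.lookup e (Some v)"

definition lvars :: "lexp \<Rightarrow> avar set" where
  "lvars e = {v. coef e v \<noteq> 0}"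

definition smul :: "int \<Rightarrow> lexp \<Rightarrow> lexp" where
  "smul k e = Poly_Mapping.map ((*) k) e"

definition leval :: "(avar \<Rightarrow> int) \<Rightarrow> lexp \<Rightarrow> int" where
  "leval \<sigma> e = (\<Sum>x\<in>Poly_Mapping.keys e.
     Poly_Mapping.lookup e x * (case x of None \<Rightarrow> 1 | Some v \<Rightarrow> \<sigma> v))"

definition lsubst :: "avar \<Rightarrow> lexp \<Rightarrow> lexp \<Rightarrow> lexp" where
  "lsubst v t e = e - mon (coef e v) v + smul (coef e v) t"

text \<open>\<open>Sym k\<close> are the symbols from which input schemata are built. \<open>BarPos p \<alpha>\<close> and
  \<open>BarNeg p \<alpha>\<close> are the reserved symbols \<open>p\<close>-bar-\<open>\<alpha>\<^sup>+\<close> and \<open>p\<close>-bar-\<open>\<alpha>\<^sup>-\<close>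
  (the sets \<open>V\<^sup>+\<close> and \<open>V\<^sup>-\<close>).\<close>

datatype psym = Sym nat | BarPos psym int | BarNeg psym int

datatype iconn = BigOr | BigAnd

datatype schema =
    Top | Bot
  | Less lexp lexp
  | Atom psym lexp
  | Neg schema
  | Or schema schema
  | And schema schema
  | Iter iconn avar lexp lexp schema

definition Imp :: "schema \<Rightarrow> schema \<Rightarrow> schema" where
  "Imp \<phi> \<psi> = Or (Neg \<phi>) \<psi>"

definition Iff :: "schema \<Rightarrow> schema \<Rightarrow> schema" where
  "Iff \<phi> \<psi> = And (Imp \<phi> \<psi>) (Imp \<psi> \<phi>)"

definition Leq :: "lexp \<Rightarrow> lexp \<Rightarrow> schema" where
  "Leq a b = Neg (Less b a)"

definition Equal :: "lexp \<Rightarrow> lexp \<Rightarrow> schema" where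
  "Equal a b = And (Leq a b) (Leq b a)"

primrec unit_of :: "iconn \<Rightarrow> schema" where
  "unit_of BigOr = Bot"
| "unit_of BigAnd = Top"

primrec join_of :: "iconn \<Rightarrow> schema \<Rightarrow> schema \<Rightarrow> schema" where
  "join_of BigOr = Or"
| "join_of BigAnd = And"

fun chain :: "iconn \<Rightarrow> schema list \<Rightarrow> schema" where
  "chain c [] = unit_of c"
| "chain c [\<phi>] = \<phi>"
| "chain c (\<phi> # \<psi> # \<psi>s) = join_of c \<phi> (chain c (\<psi> # \<psi>s))"

primrec subs :: "schema \<Rightarrow> schema set" where
  "subs Top = {Top}"
| "subs Bot = {Bot}"
| "subs (Less a b) = {Less a b}"
| "subs (Atom p e) = {Atom p e}"
| "subs (Neg \<phi>) = insert (Neg \<phi>) (subs \<phi>)"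
| "subs (Or \<phi> \<psi>) = insert (Or \<phi> \<psi>) (subs \<phi> \<union> subs \<psi>)"
| "subs (And \<phi> \<psi>) = insert (And \<phi> \<psi>) (subs \<phi> \<union> subs \<psi>)"
| "subs (Iter c i a b \<phi>) = insert (Iter c i a b \<phi>) (subs \<phi>)"

definition bv :: "schema \<Rightarrow> avar set" where
  "bv \<phi> = {i. \<exists>c a b \<psi>. Iter c i a b \<psi> \<in> subs \<phi>}"

primrec fv :: "schema \<Rightarrow> avar set" where
  "fv Top = {}"
| "fv Bot = {}"
| "fv (Less a b) = lvars a \<union> lvars b"
| "fv (Atom p e) = lvars e"
| "fv (Neg \<phi>) = fv \<phi>"
| "fv (Or \<phi> \<psi>) = fv \<phi> \<union> fv \<psi>"
| "fv (And \<phi> \<psi>) = fv \<phi> \<union> fv \<psi>"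
| "fv (Iter c i a b \<phi>) = lvars a \<union> lvars b \<union> (fv \<phi> - {i})"

definition psyms :: "schema \<Rightarrow> psym set" where
  "psyms \<phi> = {p. \<exists>e. Atom p e \<in> subs \<phi>}"

definition indices :: "schema \<Rightarrow> lexp set" where
  "indices \<phi> = {e. \<exists>p. Atom p e \<in> subs \<phi>}"

definition lower_bounds :: "schema \<Rightarrow> lexp set" where
  "lower_bounds \<phi> = {a. \<exists>c i b \<psi>. Iter c i a b \<psi> \<in> subs \<phi>}"

definition upper_bounds :: "schema \<Rightarrow> lexp set" where
  "upper_bounds \<phi> = {b. \<exists>c i a \<psi>. Iter c i a b \<psi> \<in> subs \<phi>}"

text \<open>The grammar's side condition: no \<open><\<close> inside an iteration.\<close>

definition is_schema :: "schema \<Rightarrow> bool" where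
  "is_schema \<phi> \<longleftrightarrow>
     (\<forall>c i a b \<psi>. Iter c i a b \<psi> \<in> subs \<phi> \<longrightarrow> (\<forall>d e. Less d e \<notin> subs \<psi>))"

text \<open>The naming convention, relative to the parameter \<open>n\<close>: no variable is both free and
  bound, \<open>n\<close> is not bound, and distinct iterations use distinct variables. Copies of one and
  the same iteration may share their variable; an iteration nested in an iteration over the
  same variable is excluded, since the two would have to be equal.\<close>

definition well_named :: "avar \<Rightarrow> schema \<Rightarrow> bool" where
  "well_named n \<phi> \<longleftrightarrow> n \<notin> bv \<phi> \<and> fv \<phi> \<inter> bv \<phi> = {} \<and>
     (\<forall>i c a b \<psi> c' a' b' \<psi>'.
        Iter c i a b \<psi> \<in> subs \<phi> \<longrightarrow> Iter c' i a' b' \<psi>' \<in> subs \<phi> \<longrightarrow>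
        Iter c i a b \<psi> = Iter c' i a' b' \<psi>')"

text \<open>\<open>subst v t \<phi>\<close> is \<open>\<phi>[t/v]\<close> for a free variable \<open>v\<close>. It does not rename bound
  variables; wherever it is used, the naming convention excludes capture.\<close>

primrec subst :: "avar \<Rightarrow> lexp \<Rightarrow> schema \<Rightarrow> schema" where
  "subst v t Top = Top"
| "subst v t Bot = Bot"
| "subst v t (Less a b) = Less (lsubst v t a) (lsubst v t b)"
| "subst v t (Atom p e) = Atom p (lsubst v t e)"
| "subst v t (Neg \<phi>) = Neg (subst v t \<phi>)"
| "subst v t (Or \<phi> \<psi>) = Or (subst v t \<phi>) (subst v t \<psi>)"
| "subst v t (And \<phi> \<psi>) = And (subst v t \<phi>) (subst v t \<psi>)"
| "subst v t (Iter c i a b \<phi>) =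
     Iter c i (lsubst v t a) (lsubst v t b) (if i = v then \<phi> else subst v t \<phi>)"

text \<open>\<open>repl y x \<phi>\<close> is \<open>\<phi>[x/y]\<close> for a schema \<open>y\<close>: all occurrences are replaced.\<close>

primrec repl :: "schema \<Rightarrow> schema \<Rightarrow> schema \<Rightarrow> schema" where
  "repl y x Top = (if Top = y then x else Top)"
| "repl y x Bot = (if Bot = y then x else Bot)"
| "repl y x (Less a b) = (if Less a b = y then x else Less a b)"
| "repl y x (Atom p e) = (if Atom p e = y then x else Atom p e)"
| "repl y x (Neg \<phi>) = (if Neg \<phi> = y then x else Neg (repl y x \<phi>))"
| "repl y x (Or \<phi> \<psi>) = (if Or \<phi> \<psi> = y then x else Or (repl y x \<phi>) (repl y x \<psi>))"
| "repl y x (And \<phi> \<psi>) = (if And \<phi> \<psi> = y then x else And (repl y x \<phi>) (repl y x \<psi>))"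
| "repl y x (Iter c i a b \<phi>) =
     (if Iter c i a b \<phi> = y then x else Iter c i a b (repl y x \<phi>))"

text \<open>Equality up to renaming of bound variables.\<close>

inductive alpha :: "schema \<Rightarrow> schema \<Rightarrow> bool" where
  alpha_refl: "alpha \<phi> \<phi>"
| alpha_sym: "alpha \<phi> \<psi> \<Longrightarrow> alpha \<psi> \<phi>"
| alpha_trans: "alpha \<phi> \<psi> \<Longrightarrow> alpha \<psi> \<chi> \<Longrightarrow> alpha \<phi> \<chi>"
| alpha_Neg: "alpha \<phi> \<phi>' \<Longrightarrow> alpha (Neg \<phi>) (Neg \<phi>')"
| alpha_Or: "alpha \<phi> \<phi>' \<Longrightarrow> alpha \<psi> \<psi>' \<Longrightarrow> alpha (Or \<phi> \<psi>) (Or \<phi>' \<psi>')"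
| alpha_And: "alpha \<phi> \<phi>' \<Longrightarrow> alpha \<psi> \<psi>' \<Longrightarrow> alpha (And \<phi> \<psi>) (And \<phi>' \<psi>')"
| alpha_Iter: "alpha \<phi> \<phi>' \<Longrightarrow> alpha (Iter c i a b \<phi>) (Iter c i a b \<phi>')"
| alpha_rename: "j \<notin> fv \<phi> \<union> bv \<phi> \<Longrightarrow>
    alpha (Iter c i a b \<phi>) (Iter c j a b (subst i (mon 1 j) \<phi>))"


section \<open>Semantics\<close>

primrec models :: "(avar \<Rightarrow> int) \<Rightarrow> (psym \<Rightarrow> int \<Rightarrow> bool) \<Rightarrow> schema \<Rightarrow> bool" where
  "models \<sigma> \<nu> Top \<longleftrightarrow> True"
| "models \<sigma> \<nu> Bot \<longleftrightarrow> False"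
| "models \<sigma> \<nu> (Less a b) \<longleftrightarrow> leval \<sigma> a < leval \<sigma> b"
| "models \<sigma> \<nu> (Atom p e) \<longleftrightarrow> \<nu> p (leval \<sigma> e)"
| "models \<sigma> \<nu> (Neg \<phi>) \<longleftrightarrow> \<not> models \<sigma> \<nu> \<phi>"
| "models \<sigma> \<nu> (Or \<phi> \<psi>) \<longleftrightarrow> models \<sigma> \<nu> \<phi> \<or> models \<sigma> \<nu> \<psi>"
| "models \<sigma> \<nu> (And \<phi> \<psi>) \<longleftrightarrow> models \<sigma> \<nu> \<phi> \<and> models \<sigma> \<nu> \<psi>"
| "models \<sigma> \<nu> (Iter c i a b \<phi>) \<longleftrightarrow>
     (case c of
        BigOr \<Rightarrow> \<exists>k\<in>{leval \<sigma> a..leval \<sigma> b}. models (\<sigma>(i := k)) \<nu> \<phi>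
      | BigAnd \<Rightarrow> \<forall>k\<in>{leval \<sigma> a..leval \<sigma> b}. models (\<sigma>(i := k)) \<nu> \<phi>)"

definition satisfiable :: "schema \<Rightarrow> bool" where
  "satisfiable \<phi> \<longleftrightarrow> (\<exists>\<sigma> \<nu>. (\<forall>v\<in>fv \<phi>. 0 \<le> \<sigma> v) \<and> models \<sigma> \<nu> \<phi>)"


section \<open>Normalized bound-linear schemata\<close>

definition bound_linear :: "avar \<Rightarrow> schema \<Rightarrow> bool" where
  "bound_linear n \<phi> \<longleftrightarrow> is_schema \<phi> \<and> well_named n \<phi> \<and> fv \<phi> \<subseteq> {n} \<and>
     (\<forall>e\<in>indices \<phi>. \<exists>\<alpha> \<beta> \<gamma> i. e = mon \<alpha> n + mon \<beta> i + cst \<gamma> \<and>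
        \<beta> \<in> {-1, 0, 1} \<and> (\<beta> \<noteq> 0 \<longrightarrow> i \<in> bv \<phi>)) \<and>
     (\<forall>a\<in>lower_bounds \<phi>. \<exists>\<alpha> \<beta>. a = mon \<alpha> n + cst \<beta>) \<and>
     (\<forall>b\<in>upper_bounds \<phi>. \<exists>\<gamma> \<delta> \<epsilon> j. b = mon \<gamma> n + cst \<delta> + mon \<epsilon> j \<and>
        \<epsilon> \<in> {-1, 0, 1} \<and> (\<epsilon> \<noteq> 0 \<longrightarrow> j \<in> bv \<phi>))"

definition normalized :: "avar \<Rightarrow> schema \<Rightarrow> bool" where
  "normalized n \<phi> \<longleftrightarrow>
     (\<forall>e \<in> indices \<phi> \<union> lower_bounds \<phi> \<union> upper_bounds \<phi>. even (coef e n))"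


section \<open>Auxiliary notions of the rewrite system\<close>

text \<open>\<open>vmin \<phi> v e\<close> and \<open>vmax \<phi> v e\<close> state that \<open>e\<close> is the minimum resp. maximum expression
  of the variable \<open>v\<close> in \<open>\<phi>\<close>. Pushing the minimum through \<open>+\<close> and \<open>-\<close> of an expression
  in normal form takes the minimum of the variables with positive coefficient and the maximum
  of those with negative coefficient; the maximum is dual.\<close>

definition lin_ext :: "(avar \<Rightarrow> lexp) \<Rightarrow> (avar \<Rightarrow> lexp) \<Rightarrow> lexp \<Rightarrow> lexp" where
  "lin_ext f g a = cst (Poly_Mapping.lookup a None) +
     (\<Sum>v\<in>lvars a. smul (coef a v) (if coef a v > 0 then f v else g v))"

inductive vmin :: "schema \<Rightarrow> avar \<Rightarrow> lexp \<Rightarrow> bool"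
  and vmax :: "schema \<Rightarrow> avar \<Rightarrow> lexp \<Rightarrow> bool" for \<phi> :: schema where
  vmin_free: "v \<in> fv \<phi> \<Longrightarrow> vmin \<phi> v (mon 1 v)"
| vmax_free: "v \<in> fv \<phi> \<Longrightarrow> vmax \<phi> v (mon 1 v)"
| vmin_bound: "Iter c v a b \<psi> \<in> subs \<phi> \<Longrightarrow>
    (\<forall>w\<in>lvars a. vmin \<phi> w (lo w) \<and> vmax \<phi> w (hi w)) \<Longrightarrow> vmin \<phi> v (lin_ext lo hi a)"
| vmax_bound: "Iter c v a b \<psi> \<in> subs \<phi> \<Longrightarrow>
    (\<forall>w\<in>lvars b. vmin \<phi> w (lo w) \<and> vmax \<phi> w (hi w)) \<Longrightarrow> vmax \<phi> v (lin_ext hi lo b)"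

primrec unfold :: "(avar \<Rightarrow> int) \<Rightarrow> schema \<Rightarrow> schema" where
  "unfold \<sigma> Top = Top"
| "unfold \<sigma> Bot = Bot"
| "unfold \<sigma> (Less a b) = Less (cst (leval \<sigma> a)) (cst (leval \<sigma> b))"
| "unfold \<sigma> (Atom p e) = Atom p (cst (leval \<sigma> e))"
| "unfold \<sigma> (Neg \<phi>) = Neg (unfold \<sigma> \<phi>)"
| "unfold \<sigma> (Or \<phi> \<psi>) = Or (unfold \<sigma> \<phi>) (unfold \<sigma> \<psi>)"
| "unfold \<sigma> (And \<phi> \<psi>) = And (unfold \<sigma> \<phi>) (unfold \<sigma> \<psi>)"
| "unfold \<sigma> (Iter c i a b \<phi>) =
     chain c (map (\<lambda>k. unfold (\<sigma>(i := k)) \<phi>) [leval \<sigma> a..leval \<sigma> b])"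

text \<open>\<open>inst n \<kappa> \<psi>\<close> is \<open>[\<psi>]\<close> with \<open>n\<close> replaced by \<open>\<kappa>\<close>. The default value \<open>0\<close> is
  irrelevant, as \<open>n\<close> is the only free variable of the schemata concerned.\<close>

definition inst :: "avar \<Rightarrow> int \<Rightarrow> schema \<Rightarrow> schema" where
  "inst n \<kappa> \<psi> = unfold ((\<lambda>_. 0)(n := \<kappa>)) \<psi>"

text \<open>\<open>at_iter R G \<phi> \<phi>'\<close>: \<open>\<phi>'\<close> results from \<open>\<phi>\<close> by rewriting one occurrence of an iteration
  by \<open>R\<close>; the first argument of \<open>R\<close> lists the iterations containing this occurrence.\<close>

inductive at_iter ::
  "(schema list \<Rightarrow> schema \<Rightarrow> schema \<Rightarrow> bool) \<Rightarrow> schema list \<Rightarrow> schema \<Rightarrow> schema \<Rightarrow> bool"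
  for R :: "schema list \<Rightarrow> schema \<Rightarrow> schema \<Rightarrow> bool" where
  "R G (Iter c i a b \<phi>) \<phi>' \<Longrightarrow> at_iter R G (Iter c i a b \<phi>) \<phi>'"
| "at_iter R G \<phi> \<phi>' \<Longrightarrow> at_iter R G (Neg \<phi>) (Neg \<phi>')"
| "at_iter R G \<phi> \<phi>' \<Longrightarrow> at_iter R G (Or \<phi> \<psi>) (Or \<phi>' \<psi>)"
| "at_iter R G \<psi> \<psi>' \<Longrightarrow> at_iter R G (Or \<phi> \<psi>) (Or \<phi> \<psi>')"
| "at_iter R G \<phi> \<phi>' \<Longrightarrow> at_iter R G (And \<phi> \<psi>) (And \<phi>' \<psi>)"
| "at_iter R G \<psi> \<psi>' \<Longrightarrow> at_iter R G (And \<phi> \<psi>) (And \<phi> \<psi>')"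
| "at_iter R (Iter c i a b \<phi> # G) \<phi> \<phi>' \<Longrightarrow>
     at_iter R G (Iter c i a b \<phi>) (Iter c i a b \<phi>')"

definition fresh :: "psym \<Rightarrow> schema \<Rightarrow> bool" where
  "fresh p \<phi> \<longleftrightarrow> p \<in> range Sym \<and> p \<notin> psyms \<phi>"

definition inside_iter :: "schema \<Rightarrow> schema \<Rightarrow> bool" where
  "inside_iter \<chi> \<phi> \<longleftrightarrow> (\<exists>c j d e \<psi>. Iter c j d e \<psi> \<in> subs \<phi> \<and> \<chi> \<in> subs \<psi>)"


subsection \<open>Elimination of the parameter from indices\<close>

text \<open>\<open>overline n B \<phi> \<phi>'\<close>: \<open>\<phi>'\<close> is an overlined version of \<open>\<phi>\<close>, where \<open>B\<close> is the set of bound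
  variables of the whole schema. There is none if some index has neither of the two forms.\<close>

definition bar_arg :: "avar set \<Rightarrow> lexp set" where
  "bar_arg B = {mon 1 i + cst \<beta> | i \<beta>. i \<in> B} \<union> {cst (int k) | k. True}"

inductive overline :: "avar \<Rightarrow> avar set \<Rightarrow> schema \<Rightarrow> schema \<Rightarrow> bool"
  for n :: avar and B :: "avar set" where
  "overline n B Top Top"
| "overline n B Bot Bot"
| "overline n B (Less a b) (Less a b)"
| "a \<in> bar_arg B \<Longrightarrow> overline n B (Atom p (mon (2 * \<alpha>) n + a)) (Atom (BarPos p \<alpha>) a)"
| "a \<in> bar_arg B \<Longrightarrow> overline n B (Atom p (mon (2 * \<alpha>) n - a)) (Atom (BarNeg p \<alpha>) a)"
| "overline n B \<phi> \<phi>' \<Longrightarrow> overline n B (Neg \<phi>) (Neg \<phi>')"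
| "overline n B \<phi> \<phi>' \<Longrightarrow> overline n B \<psi> \<psi>' \<Longrightarrow> overline n B (Or \<phi> \<psi>) (Or \<phi>' \<psi>')"
| "overline n B \<phi> \<phi>' \<Longrightarrow> overline n B \<psi> \<psi>' \<Longrightarrow> overline n B (And \<phi> \<psi>) (And \<phi>' \<psi>')"
| "overline n B \<phi> \<phi>' \<Longrightarrow> overline n B (Iter c i a b \<phi>) (Iter c i a b \<phi>')"

definition psi_arg :: "avar \<Rightarrow> lexp set" where
  "psi_arg n = {mon 1 n + cst \<beta> | \<beta>. True} \<union> range cst"

definition Psi :: "avar \<Rightarrow> schema set" where
  "Psi n =
     {Imp (Equal (mon (2 * \<alpha>) n + a) (mon (2 * \<beta>) n - b))
          (Iff (Atom (BarPos p \<alpha>) a) (Atom (BarNeg p \<beta>) b))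
        | p \<alpha> \<beta> a b. a \<in> psi_arg n \<and> b \<in> psi_arg n} \<union>
     {Imp (Equal (mon (2 * \<alpha>) n + a) (mon (2 * \<beta>) n + b))
          (Iff (Atom (BarPos p \<alpha>) a) (Atom (BarPos p \<beta>) b))
        | p \<alpha> \<beta> a b. a \<in> psi_arg n \<and> b \<in> psi_arg n} \<union>
     {Imp (Equal (mon (2 * \<alpha>) n - a) (mon (2 * \<beta>) n - b))
          (Iff (Atom (BarNeg p \<alpha>) a) (Atom (BarNeg p \<beta>) b))
        | p \<alpha> \<beta> a b. a \<in> psi_arg n \<and> b \<in> psi_arg n}"

text \<open>Relevance of \<open>\<theta> \<in> \<Psi>\<close> with respect to the schema whose overlined version is \<open>\<phi>'\<close>,
  as witnessed by the value \<open>\<kappa>\<close> of \<open>n\<close>.\<close>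

definition relevant_at :: "avar \<Rightarrow> schema \<Rightarrow> nat \<Rightarrow> schema \<Rightarrow> bool" where
  "relevant_at n \<phi>' \<kappa> \<theta> \<longleftrightarrow> (\<exists>\<chi> u v. \<theta> = Imp \<chi> (Iff u v) \<and> u \<noteq> v \<and>
     (\<forall>\<sigma> \<nu>. models \<sigma> \<nu> (subst n (cst (int \<kappa>)) \<chi>)) \<and>
     subst n (cst (int \<kappa>)) u \<in> subs (inst n (int \<kappa>) \<phi>') \<and>
     subst n (cst (int \<kappa>)) v \<in> subs (inst n (int \<kappa>) \<phi>'))"

text \<open>The admissible choices of the finite set \<open>\<Psi>(\<phi>)\<close>.\<close>

definition Psi_choice :: "avar \<Rightarrow> schema \<Rightarrow> schema set \<Rightarrow> bool" where
  "Psi_choice n \<phi>' S \<longleftrightarrow> finite S \<and> S \<subseteq> Psi n \<and>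
     (\<forall>\<theta>\<in>Psi n. \<forall>\<kappa>. relevant_at n \<phi>' \<kappa> \<theta> \<longrightarrow>
        (\<exists>\<theta>'\<in>S. \<forall>\<sigma> \<nu>. models \<sigma> \<nu> (subst n (cst (int \<kappa>)) \<theta>) \<longleftrightarrow>
                      models \<sigma> \<nu> (subst n (cst (int \<kappa>)) \<theta>')))"


section \<open>The rewrite rules\<close>

text \<open>Each rule is stated for schemata that obey the naming convention.\<close>

inductive tau1_local :: "schema list \<Rightarrow> schema \<Rightarrow> schema \<Rightarrow> bool" where
  "Atom p e \<in> subs \<phi> \<Longrightarrow> lvars e \<subseteq> fv (Iter c i a b \<phi>) \<Longrightarrow>
   \<forall>\<Gamma>\<in>set G. lvars e \<inter> bv \<Gamma> \<noteq> {} \<Longrightarrow>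
   tau1_local G (Iter c i a b \<phi>)
     (Or (And (Atom p e) (Iter c i a b (repl (Atom p e) Top \<phi>)))
         (And (Neg (Atom p e)) (Iter c i a b (repl (Atom p e) Bot \<phi>))))"

definition tau1 :: "schema \<Rightarrow> schema \<Rightarrow> bool" where
  "tau1 = at_iter tau1_local []"

inductive tau2 :: "avar \<Rightarrow> schema \<Rightarrow> schema \<Rightarrow> bool" for n :: avar where
  "\<pi> = Iter c i a b \<phi> \<Longrightarrow> inside_iter \<pi> \<psi> \<Longrightarrow> fv \<pi> \<subseteq> {n} \<Longrightarrow> fresh p \<psi> \<Longrightarrow>
   tau2 n \<psi> (And (Iff (Atom p (cst k)) \<pi>) (repl \<pi> (Atom p (cst k)) \<psi>))"

text \<open>The literals over the new symbol in the primed and unprimed variants.\<close>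

primrec base_lit :: "iconn \<Rightarrow> schema \<Rightarrow> schema" where
  "base_lit BigOr \<phi> = Neg \<phi>"
| "base_lit BigAnd \<phi> = \<phi>"

text \<open>\<open>tau3 n BigOr\<close> is \<open>\<tau>\<^sub>3\<close> and \<open>tau3 n BigAnd\<close> is \<open>\<tau>\<^sub>3'\<close>; likewise for \<open>tau4\<close>.\<close>

inductive tau3 :: "avar \<Rightarrow> iconn \<Rightarrow> schema \<Rightarrow> schema \<Rightarrow> bool"
  for n :: avar and c :: iconn where
  "\<pi> = Iter c i a (b + mon 1 j) \<psi> \<Longrightarrow> inside_iter \<pi> \<phi> \<Longrightarrow> j \<in> bv \<phi> \<Longrightarrow>
   lvars a \<subseteq> {n} \<Longrightarrow> lvars b \<subseteq> {n} \<Longrightarrow> fv \<psi> \<subseteq> {n, i} \<Longrightarrow> fresh p \<phi> \<Longrightarrow>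
   vmin \<phi> j lo \<Longrightarrow> vmax \<phi> j hi \<Longrightarrow>
   tau3 n c \<phi> (chain BigAnd
     [base_lit c (Atom p (a - b - cst 1)),
      Iter BigAnd j lo (a - b - cst 1) (base_lit c (Atom p (mon 1 j))),
      Iter BigAnd j (a - b) hi
        (Iff (Atom p (mon 1 j))
             (join_of c (Atom p (mon 1 j - cst 1)) (subst i (b + mon 1 j) \<psi>))),
      repl \<pi> (Atom p (mon 1 j)) \<phi>])"

inductive tau4 :: "avar \<Rightarrow> iconn \<Rightarrow> schema \<Rightarrow> schema \<Rightarrow> bool"
  for n :: avar and c :: iconn where
  "\<pi> = Iter c i a (b - mon 1 j) \<psi> \<Longrightarrow> inside_iter \<pi> \<phi> \<Longrightarrow> j \<in> bv \<phi> \<Longrightarrow>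
   lvars a \<subseteq> {n} \<Longrightarrow> lvars b \<subseteq> {n} \<Longrightarrow> fv \<psi> \<subseteq> {n, i} \<Longrightarrow> fresh p \<phi> \<Longrightarrow>
   vmin \<phi> j lo \<Longrightarrow> vmax \<phi> j hi \<Longrightarrow>
   tau4 n c \<phi> (chain BigAnd
     [base_lit c (Atom p (b - a + cst 1)),
      Iter BigAnd j (b - a + cst 1) hi (base_lit c (Atom p (mon 1 j))),
      Iter BigAnd j lo (b - a)
        (Iff (Atom p (mon 1 j))
             (join_of c (Atom p (mon 1 j + cst 1)) (subst i (b - mon 1 j) \<psi>))),
      repl \<pi> (Atom p (mon 1 j)) \<phi>])"

inductive tau5_local :: "avar \<Rightarrow> schema \<Rightarrow> schema \<Rightarrow> bool" for n :: avar where
  "\<alpha> \<noteq> 0 \<Longrightarrow>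
   tau5_local n (Iter c i (mon \<alpha> n + cst \<beta>) (mon \<gamma> n - cst \<delta>) \<phi>)
     (Iter c i (cst \<beta>) (mon (\<gamma> - \<alpha>) n - cst \<delta>) (subst i (mon 1 i + mon \<alpha> n) \<phi>))"

definition tau5 :: "avar \<Rightarrow> schema \<Rightarrow> schema \<Rightarrow> bool" where
  "tau5 n = at_iter (\<lambda>_. tau5_local n) []"

text \<open>The list \<open>[0..\<kappa>]\<close> of integers is empty if \<open>\<kappa> < 0\<close>.\<close>

inductive tau6 :: "avar \<Rightarrow> schema \<Rightarrow> schema \<Rightarrow> bool" for n :: avar where
  "\<pi> = Iter c i (cst \<gamma>) (mon \<alpha> n - cst \<beta>) \<phi> \<Longrightarrow> \<pi> \<in> subs \<psi> \<Longrightarrow> \<alpha> < 0 \<Longrightarrow>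
   \<kappa> = \<lceil>real_of_int (\<gamma> + \<beta>) / real_of_int \<alpha>\<rceil> \<Longrightarrow>
   tau6 n \<psi> (chain BigOr
     (map (\<lambda>k. inst n k \<psi>) [0..\<kappa>] @ [And (Less (cst \<kappa>) (mon 1 n)) (repl \<pi> (unit_of c) \<psi>)]))"

inductive tau7 :: "avar \<Rightarrow> schema \<Rightarrow> schema \<Rightarrow> bool" for n :: avar where
  "\<pi> = Iter c i (cst \<gamma>) (mon \<alpha> n - cst \<beta>) \<phi> \<Longrightarrow> \<pi> \<in> subs \<psi> \<Longrightarrow> \<alpha> > 1 \<Longrightarrow>
   \<kappa> = \<lfloor>real_of_int (\<gamma> + \<beta>) / real_of_int (\<alpha> - 1)\<rfloor> \<Longrightarrow>
   \<psi>' = join_of c (Iter c i (cst \<gamma>) (mon (\<alpha> - 1) n - cst \<beta>) \<phi>)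
          (Iter c i (cst 1) (mon 1 n) (subst i (mon 1 i + mon (\<alpha> - 1) n - cst \<beta>) \<phi>)) \<Longrightarrow>
   tau7 n \<psi> (chain BigOr
     (And (Leq (cst \<gamma>) (mon (\<alpha> - 1) n - cst \<beta>)) (repl \<pi> \<psi>' \<psi>) #
      map (\<lambda>k. inst n k \<psi>) [0..\<kappa>]))"

text \<open>The body must contain an index: on bodies without indices the rule would apply
  vacuously and for ever.\<close>

inductive tau8_local :: "avar \<Rightarrow> schema \<Rightarrow> schema \<Rightarrow> bool" for n :: avar where
  "indices \<phi> \<noteq> {} \<Longrightarrow> \<forall>e\<in>indices \<phi>. odd (coef e n) \<Longrightarrow>
   tau8_local n (Iter c i (cst \<gamma>) (mon 1 n - cst \<beta>) \<phi>)
     (Iter c i (cst \<beta>) (mon 1 n - cst \<gamma>) (subst i (mon 1 n - mon 1 i) \<phi>))"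

definition tau8 :: "avar \<Rightarrow> schema \<Rightarrow> schema \<Rightarrow> bool" where
  "tau8 n = at_iter (\<lambda>_. tau8_local n) []"

text \<open>A symbol lies outside \<open>V\<^sup>+ \<union> V\<^sup>-\<close> iff it is a \<open>Sym\<close> symbol.\<close>

inductive tau9 :: "avar \<Rightarrow> schema \<Rightarrow> schema \<Rightarrow> bool" for n :: avar where
  "p \<in> psyms \<phi> \<Longrightarrow> p \<in> range Sym \<Longrightarrow> overline n (bv \<phi>) \<phi> \<phi>' \<Longrightarrow>
   Psi_choice n \<phi>' (set \<theta>s) \<Longrightarrow> tau9 n \<phi> (And \<phi>' (chain BigAnd \<theta>s))"

text \<open>\<open>max_lower \<phi> \<alpha>'\<close> and \<open>min_upper n \<phi> \<beta>'\<close>: the maximal lower bound is \<open>\<alpha>'\<close> and the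
  minimal upper bound is \<open>n - \<beta>'\<close>.\<close>

definition max_lower :: "schema \<Rightarrow> int \<Rightarrow> bool" where
  "max_lower \<phi> \<alpha>' \<longleftrightarrow> cst \<alpha>' \<in> lower_bounds \<phi> \<and> (\<forall>k. cst k \<in> lower_bounds \<phi> \<longrightarrow> k \<le> \<alpha>')"

definition min_upper :: "avar \<Rightarrow> schema \<Rightarrow> int \<Rightarrow> bool" where
  "min_upper n \<phi> \<beta>' \<longleftrightarrow> mon 1 n - cst \<beta>' \<in> upper_bounds \<phi> \<and>
     (\<forall>k. mon 1 n - cst k \<in> upper_bounds \<phi> \<longrightarrow> k \<le> \<beta>')"

inductive tau10_local :: "avar \<Rightarrow> int \<Rightarrow> int \<Rightarrow> schema \<Rightarrow> schema \<Rightarrow> bool"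
  for n :: avar and \<alpha>' \<beta>' :: int where
  "\<alpha> \<noteq> \<alpha>' \<or> \<beta> \<noteq> \<beta>' \<Longrightarrow>
   tau10_local n \<alpha>' \<beta>' (Iter c i (cst \<alpha>) (mon 1 n - cst \<beta>) \<phi>)
     (Or (And (Less (mon 1 n) (cst (\<alpha> + \<beta>))) (unit_of c))
         (And (Leq (cst (\<alpha> + \<beta>)) (mon 1 n))
              (join_of c
                 (Iter c i (cst \<alpha>') (mon 1 n - cst \<beta> - cst 1 + cst \<alpha>' - cst \<alpha>)
                    (subst i (mon 1 i - cst \<alpha>' + cst \<alpha>) \<phi>))
                 (subst i (mon 1 n - cst \<beta>) \<phi>))))"

definition tau10 :: "avar \<Rightarrow> schema \<Rightarrow> schema \<Rightarrow> bool" where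
  "tau10 n \<phi> \<phi>' \<longleftrightarrow> (\<exists>\<alpha>' \<beta>'. max_lower \<phi> \<alpha>' \<and> min_upper n \<phi> \<beta>' \<and>
     at_iter (\<lambda>_. tau10_local n \<alpha>' \<beta>') [] \<phi> \<phi>')"


section \<open>The rewrite system\<close>

text \<open>A rule applied up to renaming of bound variables.\<close>

definition mod_alpha ::
  "avar \<Rightarrow> (schema \<Rightarrow> schema \<Rightarrow> bool) \<Rightarrow> schema \<Rightarrow> schema \<Rightarrow> bool" where
  "mod_alpha n R \<phi> \<phi>' \<longleftrightarrow>
     (\<exists>\<psi> \<psi>'. alpha \<phi> \<psi> \<and> well_named n \<psi> \<and> R \<psi> \<psi>' \<and> alpha \<psi>' \<phi>')"

definition tau_rules :: "avar \<Rightarrow> (schema \<Rightarrow> schema \<Rightarrow> bool) list" where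
  "tau_rules n = map (mod_alpha n)
     [tau1, tau2 n, tau3 n BigOr, tau3 n BigAnd, tau4 n BigOr, tau4 n BigAnd,
      tau5 n, tau6 n, tau7 n, tau8 n, tau9 n, tau10 n]"

text \<open>A rule may be applied only if no rule presented before it is applicable.\<close>

definition tau :: "avar \<Rightarrow> schema \<Rightarrow> schema \<Rightarrow> bool" where
  "tau n \<phi> \<phi>' \<longleftrightarrow> (\<exists>k < length (tau_rules n).
     (tau_rules n ! k) \<phi> \<phi>' \<and> (\<forall>l < k. \<nexists>\<chi>. (tau_rules n ! l) \<phi> \<chi>))"

definition tau_normal_form :: "avar \<Rightarrow> schema \<Rightarrow> schema \<Rightarrow> bool" where
  "tau_normal_form n \<phi> \<psi> \<longleftrightarrow> (tau n)\<^sup>*\<^sup>* \<phi> \<psi> \<and> (\<nexists>\<chi>. tau n \<psi> \<chi>)"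

end

theory Submission
  imports Defs
begin

text \<open>Every single rewrite step preserves satisfiability, so neither termination nor the shape of
  the normal form matters; the only invariant needed is that no variable other than \<open>n\<close> is free.
  The rules that rewrite an iteration in place and the replacements in \<open>\<tau>\<^sub>6\<close> and \<open>\<tau>\<^sub>7\<close> are
  equivalences. In \<open>\<tau>\<^sub>2\<close>, \<open>\<tau>\<^sub>3\<close> and \<open>\<tau>\<^sub>4\<close> the fresh symbol is interpreted by the truth value of
  the iteration it abbreviates; conversely, the added conjuncts force this interpretation at all
  points at which the schema is evaluated, since the bound variable \<open>j\<close> never leaves the interval
  between its minimum and its maximum expression. For \<open>\<tau>\<^sub>9\<close>, a model of the barred schema yields
  one of the original schema because two distinct barred variables that stand for the same original
  variable are forced to agree by a relevant element of \<open>\<Psi>\<close>.\<close>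

section \<open>Linear expressions\<close>

text \<open>\<open>subst\<close> and \<open>repl\<close> never rename, so each use needs an argument
  against capture, drawn from the naming convention. The rules themselves break that convention:
  \<open>tau1\<close> leaves two different iterations over one variable, and \<open>tau3\<close> and
  \<open>tau4\<close> add iterations over \<open>j\<close>. It is therefore assumed afresh at each
  step, for the well-named variant chosen in \<open>mod_alpha\<close>, and is not part of the
  invariant.

  The main obstacle is replacement below binders. The schema put in agrees with the one taken out
  only for values that the bound variables really take, so evaluation is traced from the assignment
  at the root to those at the occurrences. Extremal expressions are evaluated at the root, whereas
  \<open>j\<close> gets its value on the way; that there is just one iteration over each bound
  variable links the two.

  In \<open>tau9\<close> the added conjuncts are only guaranteed to relate barred variables that
  occur in the unfolding for the given value of \<open>n\<close>. Evaluation before and after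
  overlining is hence compared at the atoms of that unfolding.\<close>

lemma leval_superset:
  assumes "finite A" "Poly_Mapping.keys e \<subseteq> A"
  shows "leval \<sigma> e = (\<Sum>x\<in>A. Poly_Mapping.lookup e x * (case x of None \<Rightarrow> 1 | Some v \<Rightarrow> \<sigma> v))"
  unfolding leval_def using assms
  by (intro sum.mono_neutral_left) (auto simp: in_keys_iff)

lemma leval_add [simp]: "leval \<sigma> (a + b) = leval \<sigma> a + leval \<sigma> b"
proof -
  \<comment> \<open>Coefficients may cancel in \<open>a + b\<close>, so all three sums are taken
    over the union of the key sets.\<close>
  let ?A = "Poly_Mapping.keys a \<union> Poly_Mapping.keys b"
  have "Poly_Mapping.keys (a + b) \<subseteq> ?A" by (rule Poly_Mapping.keys_add)
  then show ?thesis
    by (simp add: leval_superset[of ?A] lookup_add distrib_right sum.distrib)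
qed

lemma leval_uminus [simp]: "leval \<sigma> (- a) = - leval \<sigma> a"
proof -
  have "Poly_Mapping.keys (- a) = Poly_Mapping.keys a"
    by (auto simp: in_keys_iff lookup_uminus)
  then show ?thesis
    by (simp add: leval_def sum_negf)
qed

lemma leval_diff [simp]: "leval \<sigma> (a - b) = leval \<sigma> a - leval \<sigma> b"
  using leval_add[of \<sigma> a "- b"] by simp

lemma leval_cst [simp]: "leval \<sigma> (cst k) = k"
  by (subst leval_superset[of "{None}"]) (auto simp: cst_def lookup_single)

lemma leval_mon [simp]: "leval \<sigma> (mon k v) = k * \<sigma> v"
  by (subst leval_superset[of "{Some v}"]) (auto simp: mon_def lookup_single)

lemma lookup_smul: "Poly_Mapping.lookup (smul k e) x = k * Poly_Mapping.lookup e x"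
  by (simp add: smul_def map.rep_eq when_def)

lemma leval_smul [simp]: "leval \<sigma> (smul k e) = k * leval \<sigma> e"
proof -
  have "Poly_Mapping.keys (smul k e) \<subseteq> Poly_Mapping.keys e"
    by (auto simp: in_keys_iff lookup_smul)
  then show ?thesis
    by (simp add: leval_superset[of "Poly_Mapping.keys e"] lookup_smul sum_distrib_left mult.assoc)
qed

lemma leval_sum [simp]: "leval \<sigma> (\<Sum>x\<in>A. f x) = (\<Sum>x\<in>A. leval \<sigma> (f x))"
proof -
  have "leval \<sigma> 0 = 0" by (simp add: leval_def)
  then show ?thesis by (induction A rule: infinite_finite_induct) auto
qed

lemma coef_simps [simp]:
  "coef (a + b) v = coef a v + coef b v"
  "coef (a - b) v = coef a v - coef b v"
  "coef (cst k) v = 0"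
  "coef (mon k w) v = (if v = w then k else 0)"
  "coef (smul k a) v = k * coef a v"
  by (auto simp: coef_def lookup_add lookup_minus cst_def mon_def lookup_single lookup_smul)

lemma coef_sum [simp]: "coef (\<Sum>x\<in>A. f x) v = (\<Sum>x\<in>A. coef (f x) v)"
  by (simp add: coef_def lookup_sum)

lemma lvars_simps [simp]:
  "lvars (cst k) = {}"
  "lvars (mon k w) = (if k = 0 then {} else {w})"
  by (auto simp: lvars_def)

lemma lvars_add: "lvars (a + b) \<subseteq> lvars a \<union> lvars b"
  by (auto simp: lvars_def)

lemma lvars_diff: "lvars (a - b) \<subseteq> lvars a \<union> lvars b"
  by (auto simp: lvars_def)

text \<open>Disjoint supports exclude cancellation, which turns the inclusions
  \<open>lvars_add\<close> and \<open>lvars_diff\<close> into equalities.\<close>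

lemma lvars_disjoint_Un:
  assumes "lvars a \<inter> lvars b = {}"
  shows "lvars (a + b) = lvars a \<union> lvars b" "lvars (a - b) = lvars a \<union> lvars b"
proof -
  have "coef a v = 0 \<or> coef b v = 0" for v
    using assms by (auto simp: lvars_def)
  then show "lvars (a + b) = lvars a \<union> lvars b" "lvars (a - b) = lvars a \<union> lvars b"
    by (force simp: lvars_def)+
qed

lemma lvars_sum: "lvars (\<Sum>x\<in>A. f x) \<subseteq> (\<Union>x\<in>A. lvars (f x))"
  by (auto simp: lvars_def dest: sum.not_neutral_contains_not_neutral)

lemma finite_lvars [simp]: "finite (lvars e)"
proof -
  have "Some ` lvars e \<subseteq> Poly_Mapping.keys e"
    by (auto simp: lvars_def coef_def in_keys_iff)
  then have "finite (Some ` lvars e)" by (rule finite_subset) simp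
  then show ?thesis by (rule finite_imageD) (auto simp: inj_on_def)
qed

text \<open>With the constant term split off, values under two assignments can be compared summand
  by summand.\<close>

lemma leval_lvars:
  "leval \<sigma> e = Poly_Mapping.lookup e None + (\<Sum>v\<in>lvars e. coef e v * \<sigma> v)"
proof -
  have "leval \<sigma> e = (\<Sum>x\<in>insert None (Some ` lvars e).
      Poly_Mapping.lookup e x * (case x of None \<Rightarrow> 1 | Some v \<Rightarrow> \<sigma> v))"
  proof (rule leval_superset)
    show "Poly_Mapping.keys e \<subseteq> insert None (Some ` lvars e)"
    proof
      fix x assume "x \<in> Poly_Mapping.keys e"
      then show "x \<in> insert None (Some ` lvars e)"
        by (cases x) (auto simp: in_keys_iff lvars_def coef_def)
    qed
  qed simp
  also have "\<dots> = Poly_Mapping.lookup e None + (\<Sum>v\<in>lvars e. coef e v * \<sigma> v)"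
    by (subst sum.insert) (auto simp: sum.reindex coef_def)
  finally show ?thesis .
qed

lemma leval_cong: "(\<And>v. v \<in> lvars e \<Longrightarrow> \<sigma> v = \<sigma>' v) \<Longrightarrow> leval \<sigma> e = leval \<sigma>' e"
  by (simp add: leval_lvars)

lemma leval_upd [simp]: "v \<notin> lvars e \<Longrightarrow> leval (\<sigma>(v := k)) e = leval \<sigma> e"
  by (rule leval_cong) auto

lemma leval_lsubst [simp]: "leval \<sigma> (lsubst v t e) = leval (\<sigma>(v := leval \<sigma> t)) e"
proof -
  \<comment> \<open>Evaluation is affine in the value of \<open>v\<close>, with slope
    \<open>coef e v\<close>.\<close>
  have "leval (\<sigma>(v := k)) e = leval \<sigma> e + coef e v * (k - \<sigma> v)" for k
  proof -
    have "leval (\<sigma>(v := k)) (e - mon (coef e v) v) = leval \<sigma> (e - mon (coef e v) v)"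
      by (rule leval_upd) (simp add: lvars_def)
    then show ?thesis by (simp add: algebra_simps)
  qed
  from this[of "leval \<sigma> t"] show ?thesis by (simp add: lsubst_def algebra_simps)
qed

lemma lvars_lsubst: "lvars (lsubst v t e) \<subseteq> (lvars e - {v}) \<union> lvars t"
  by (auto simp: lvars_def lsubst_def)

lemma lvars_lsubst_rename:
  "j \<notin> lvars e \<Longrightarrow> lvars (lsubst i (mon 1 j) e) - {j} = lvars e - {i}"
  by (auto simp: lvars_def lsubst_def split: if_splits)


section \<open>Free and bound variables\<close>

lemma subs_refl [simp]: "\<phi> \<in> subs \<phi>"
  by (cases \<phi>) auto

lemma subs_trans: "\<chi> \<in> subs \<psi> \<Longrightarrow> \<psi> \<in> subs \<phi> \<Longrightarrow> \<chi> \<in> subs \<phi>"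
  by (induction \<phi>) auto

lemma subs_size: "\<chi> \<in> subs \<psi> \<Longrightarrow> size \<chi> \<le> size \<psi>"
  by (induction \<psi>) auto

lemma inside_iter_subs:
  assumes "inside_iter \<pi> \<phi>"
  shows "\<pi> \<in> subs \<phi>"
proof -
  obtain c i a b \<psi> where 1: "Iter c i a b \<psi> \<in> subs \<phi>" "\<pi> \<in> subs \<psi>"
    using assms by (auto simp: inside_iter_def)
  then have "\<pi> \<in> subs (Iter c i a b \<psi>)" by simp
  then show ?thesis using 1(1) by (rule subs_trans)
qed

lemma bv_simps [simp]:
  "bv Top = {}" "bv Bot = {}" "bv (Less a b) = {}" "bv (Atom p e) = {}"
  "bv (Neg \<phi>) = bv \<phi>" "bv (Or \<phi> \<psi>) = bv \<phi> \<union> bv \<psi>" "bv (And \<phi> \<psi>) = bv \<phi> \<union> bv \<psi>"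
  "bv (Iter c i a b \<phi>) = insert i (bv \<phi>)"
  by (auto simp: bv_def)

lemma bv_subs: "\<chi> \<in> subs \<psi> \<Longrightarrow> bv \<chi> \<subseteq> bv \<psi>"
  unfolding bv_def by (blast intro: subs_trans)

lemma psyms_simps [simp]:
  "psyms Top = {}" "psyms Bot = {}" "psyms (Less a b) = {}" "psyms (Atom p e) = {p}"
  "psyms (Neg \<phi>) = psyms \<phi>" "psyms (Or \<phi> \<psi>) = psyms \<phi> \<union> psyms \<psi>"
  "psyms (And \<phi> \<psi>) = psyms \<phi> \<union> psyms \<psi>" "psyms (Iter c i a b \<phi>) = psyms \<phi>"
  by (auto simp: psyms_def)

lemma psyms_subs: "\<chi> \<in> subs \<psi> \<Longrightarrow> psyms \<chi> \<subseteq> psyms \<psi>"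
  unfolding psyms_def by (blast intro: subs_trans)

text \<open>An inner iteration over \<open>i\<close> would have to equal the outer one, but it is
  strictly smaller.\<close>

lemma well_named_Iter_bv:
  assumes "well_named n (Iter c i a b \<phi>)"
  shows "i \<notin> bv \<phi>"
proof
  assume "i \<in> bv \<phi>"
  then obtain c' a' b' \<psi>' where *: "Iter c' i a' b' \<psi>' \<in> subs \<phi>" by (auto simp: bv_def)
  then have "Iter c' i a' b' \<psi>' \<in> subs (Iter c i a b \<phi>)" by simp
  with assms have "Iter c' i a' b' \<psi>' = Iter c i a b \<phi>"
    unfolding well_named_def by (meson subs_refl)
  with subs_size[OF *] show False by simp
qed

text \<open>Uniqueness of iterations passes to parts, but disjointness of free and bound variables
  does not: the body of an iteration has the iteration variable as a new free variable. Hence the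
  separate premise.\<close>

lemma well_named_mono:
  assumes "well_named n \<phi>" "subs \<psi> \<subseteq> subs \<phi>" "fv \<psi> \<inter> bv \<psi> = {}"
  shows "well_named n \<psi>"
proof -
  have "bv \<psi> \<subseteq> bv \<phi>" using assms(2) unfolding bv_def by blast
  then show ?thesis using assms unfolding well_named_def by blast
qed

lemma well_named_dests:
  "well_named n (Neg \<phi>) \<Longrightarrow> well_named n \<phi>"
  "well_named n (Or \<phi> \<psi>) \<Longrightarrow> well_named n \<phi>"
  "well_named n (Or \<phi> \<psi>) \<Longrightarrow> well_named n \<psi>"
  "well_named n (And \<phi> \<psi>) \<Longrightarrow> well_named n \<phi>"
  "well_named n (And \<phi> \<psi>) \<Longrightarrow> well_named n \<psi>"
  "well_named n (Iter c i a b \<phi>) \<Longrightarrow> well_named n \<phi>"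
proof -
  have disj: "well_named n \<chi> \<Longrightarrow> fv \<chi> \<inter> bv \<chi> = {}" for \<chi>
    by (simp add: well_named_def)
  show "well_named n \<phi>" if "well_named n (Neg \<phi>)"
    using that disj[OF that] by (auto elim!: well_named_mono)
  show "well_named n \<phi>" if "well_named n (Or \<phi> \<psi>)"
    using that disj[OF that] by (auto elim!: well_named_mono)
  show "well_named n \<psi>" if "well_named n (Or \<phi> \<psi>)"
    using that disj[OF that] by (auto elim!: well_named_mono)
  show "well_named n \<phi>" if "well_named n (And \<phi> \<psi>)"
    using that disj[OF that] by (auto elim!: well_named_mono)
  show "well_named n \<psi>" if "well_named n (And \<phi> \<psi>)"
    using that disj[OF that] by (auto elim!: well_named_mono)
  show "well_named n \<phi>" if "well_named n (Iter c i a b \<phi>)"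
    using that disj[OF that] well_named_Iter_bv[OF that] by (auto elim!: well_named_mono)
qed

lemma well_named_subs: "well_named n \<phi> \<Longrightarrow> \<chi> \<in> subs \<phi> \<Longrightarrow> well_named n \<chi>"
  by (induction \<phi>) (auto dest: well_named_dests)

lemma well_named_bv: "well_named n \<phi> \<Longrightarrow> n \<notin> bv \<phi>"
  by (simp add: well_named_def)

lemma well_named_disjoint: "well_named n \<phi> \<Longrightarrow> fv \<phi> \<inter> bv \<phi> = {}"
  by (simp add: well_named_def)

lemma well_named_unique:
  assumes "well_named n \<phi>" "Iter c i a b \<psi> \<in> subs \<phi>" "Iter c' i a' b' \<psi>' \<in> subs \<phi>"
  shows "c = c' \<and> a = a' \<and> b = b' \<and> \<psi> = \<psi>'"
  using assms unfolding well_named_def by blast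

lemma fv_subst: "fv (subst v t \<phi>) \<subseteq> (fv \<phi> - {v}) \<union> lvars t"
proof (induction \<phi>)
  case (Iter c i a b \<phi>)
  then show ?case
    using lvars_lsubst[of v t a] lvars_lsubst[of v t b] by auto
next
  case (Less a b)
  then show ?case
    using lvars_lsubst[of v t a] lvars_lsubst[of v t b] by auto
qed (use lvars_lsubst in auto)

lemma fv_subst_rename:
  "j \<notin> fv \<phi> \<union> bv \<phi> \<Longrightarrow> fv (subst i (mon 1 j) \<phi>) - {j} = fv \<phi> - {i}"
proof (induction \<phi>)
  case (Less a b)
  then show ?case by (simp add: Un_Diff lvars_lsubst_rename)
next
  case (Iter c k a b \<phi>)
  have ab: "lvars (lsubst i (mon 1 j) a) - {j} = lvars a - {i}"
    "lvars (lsubst i (mon 1 j) b) - {j} = lvars b - {i}"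
    using Iter.prems by (auto simp del: One_nat_def intro!: lvars_lsubst_rename)
  have "j \<notin> fv \<phi> \<union> bv \<phi>" using Iter.prems by auto
  then show ?case
    using Iter.IH ab Iter.prems by (cases "k = i") (simp_all, blast+)
qed (simp_all add: lvars_lsubst_rename Un_Diff)

text \<open>Binders above an occurrence of \<open>y\<close> remove the same variables from
  \<open>x\<close> as from \<open>y\<close>, so only \<open>n\<close> can be new.\<close>

lemma fv_repl: "fv x \<subseteq> insert n (fv y) \<Longrightarrow> n \<notin> bv \<phi> \<Longrightarrow> fv (repl y x \<phi>) \<subseteq> insert n (fv \<phi>)"
  by (induction \<phi>) auto

lemma fv_chain: "fv (chain c \<phi>s) \<subseteq> (\<Union>\<phi>\<in>set \<phi>s. fv \<phi>)"
proof (induction c \<phi>s rule: chain.induct)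
  case (1 c) then show ?case by (cases c) auto
next
  case (3 c \<phi> \<psi> \<psi>s) then show ?case by (cases c) auto
qed auto

lemma fv_unfold: "fv (unfold \<sigma> \<phi>) = {}"
proof (induction \<phi> arbitrary: \<sigma>)
  case (Iter c i a b \<phi>)
  then show ?case using fv_chain by fastforce
qed auto

section \<open>Coincidence and substitution\<close>

text \<open>The common core of renaming, shifting and reflecting an iteration. A quantifier over a
  range sees only the set of values, so \<open>f\<close> has to be onto the old range but not
  injective.\<close>

lemma models_Iter_reindex:
  assumes "f ` {leval \<sigma>' a'..leval \<sigma>' b'} = {leval \<sigma> a..leval \<sigma> b}"
    and "\<And>k. k \<in> {leval \<sigma>' a'..leval \<sigma>' b'} \<Longrightarrow>
      models (\<sigma>'(i' := k)) \<nu> \<phi>' = models (\<sigma>(i := f k)) \<nu> \<phi>"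
  shows "models \<sigma>' \<nu> (Iter c i' a' b' \<phi>') = models \<sigma> \<nu> (Iter c i a b \<phi>)"
proof -
  let ?S = "{leval \<sigma>' a'..leval \<sigma>' b'}"
  have "(\<exists>k\<in>?S. models (\<sigma>'(i' := k)) \<nu> \<phi>') \<longleftrightarrow> (\<exists>k\<in>f ` ?S. models (\<sigma>(i := k)) \<nu> \<phi>)"
    "(\<forall>k\<in>?S. models (\<sigma>'(i' := k)) \<nu> \<phi>') \<longleftrightarrow> (\<forall>k\<in>f ` ?S. models (\<sigma>(i := k)) \<nu> \<phi>)"
    using assms(2) by auto
  then show ?thesis unfolding assms(1) by (cases c) simp_all
qed

lemma models_Iter_cong:
  assumes "leval \<sigma>' a' = leval \<sigma> a" "leval \<sigma>' b' = leval \<sigma> b"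
    and "\<And>k. k \<in> {leval \<sigma> a..leval \<sigma> b} \<Longrightarrow>
      models (\<sigma>'(i' := k)) \<nu>' \<phi>' = models (\<sigma>(i := k)) \<nu> \<phi>"
  shows "models \<sigma>' \<nu>' (Iter c i' a' b' \<phi>') = models \<sigma> \<nu> (Iter c i a b \<phi>)"
  using assms by (cases c) simp_all

lemma models_cong:
  "(\<And>v. v \<in> fv \<phi> \<Longrightarrow> \<sigma> v = \<sigma>' v) \<Longrightarrow> (\<And>p. p \<in> psyms \<phi> \<Longrightarrow> \<nu> p = \<nu>' p) \<Longrightarrow>
   models \<sigma> \<nu> \<phi> = models \<sigma>' \<nu>' \<phi>"
proof (induction \<phi> arbitrary: \<sigma> \<sigma>')
  case (Less a b)
  then show ?case using leval_cong[of a \<sigma> \<sigma>'] leval_cong[of b \<sigma> \<sigma>'] by simp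
next
  case (Atom p e)
  then show ?case using leval_cong[of e \<sigma> \<sigma>'] by simp
next
  case (Neg \<phi>)
  then show ?case by (metis fv.simps(5) models.simps(5) psyms_simps(5))
next
  case (Or \<phi> \<psi>)
  have "models \<sigma> \<nu> \<phi> = models \<sigma>' \<nu>' \<phi>" "models \<sigma> \<nu> \<psi> = models \<sigma>' \<nu>' \<psi>"
    using Or.prems by (auto intro!: Or.IH)
  then show ?case by simp
next
  case (And \<phi> \<psi>)
  have "models \<sigma> \<nu> \<phi> = models \<sigma>' \<nu>' \<phi>" "models \<sigma> \<nu> \<psi> = models \<sigma>' \<nu>' \<psi>"
    using And.prems by (auto intro!: And.IH)
  then show ?case by simp
next
  case (Iter c i a b \<phi>)
  show ?case
  proof (rule models_Iter_cong)
    show "leval \<sigma> a = leval \<sigma>' a" "leval \<sigma> b = leval \<sigma>' b"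
      using Iter.prems by (auto intro!: leval_cong)
    show "models (\<sigma>(i := k)) \<nu> \<phi> = models (\<sigma>'(i := k)) \<nu>' \<phi>" for k
      using Iter.prems by (intro Iter.IH) auto
  qed
qed auto

text \<open>The premise excludes capture. At an iteration over \<open>v\<close> itself
  \<open>subst\<close> leaves the body alone, in accordance with the inner update of
  \<open>v\<close> overriding the outer one.\<close>

lemma models_subst:
  "lvars t \<inter> bv \<phi> = {} \<Longrightarrow> models \<sigma> \<nu> (subst v t \<phi>) = models (\<sigma>(v := leval \<sigma> t)) \<nu> \<phi>"
proof (induction \<phi> arbitrary: \<sigma>)
  case (Or \<phi> \<psi>)
  then show ?case by (simp add: Int_Un_distrib)
next
  case (And \<phi> \<psi>)
  then show ?case by (simp add: Int_Un_distrib)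
next
  case (Iter c i a b \<phi>)
  have "models (\<sigma>(i := k)) \<nu> (if i = v then \<phi> else subst v t \<phi>)
      = models ((\<sigma>(v := leval \<sigma> t))(i := k)) \<nu> \<phi>" for k
    using Iter by (simp add: fun_upd_twist del: fun_upd_apply)
  then show ?case
    unfolding subst.simps by (intro models_Iter_cong) (simp_all del: fun_upd_apply)
qed auto

lemma models_chain [simp]:
  "models \<sigma> \<nu> (chain BigOr \<phi>s) \<longleftrightarrow> (\<exists>\<phi>\<in>set \<phi>s. models \<sigma> \<nu> \<phi>)"
  "models \<sigma> \<nu> (chain BigAnd \<phi>s) \<longleftrightarrow> (\<forall>\<phi>\<in>set \<phi>s. models \<sigma> \<nu> \<phi>)"
proof -
  have "models \<sigma> \<nu> (chain c \<phi>s) \<longleftrightarrow>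
     (case c of BigOr \<Rightarrow> \<exists>\<phi>\<in>set \<phi>s. models \<sigma> \<nu> \<phi> | BigAnd \<Rightarrow> \<forall>\<phi>\<in>set \<phi>s. models \<sigma> \<nu> \<phi>)" for c
    by (induction c \<phi>s rule: chain.induct) (auto split: iconn.splits)
  from this[of BigOr] this[of BigAnd]
  show "models \<sigma> \<nu> (chain BigOr \<phi>s) \<longleftrightarrow> (\<exists>\<phi>\<in>set \<phi>s. models \<sigma> \<nu> \<phi>)"
    "models \<sigma> \<nu> (chain BigAnd \<phi>s) \<longleftrightarrow> (\<forall>\<phi>\<in>set \<phi>s. models \<sigma> \<nu> \<phi>)" by simp_all
qed

lemma models_derived [simp]:
  "models \<sigma> \<nu> (Imp \<phi> \<psi>) \<longleftrightarrow> (models \<sigma> \<nu> \<phi> \<longrightarrow> models \<sigma> \<nu> \<psi>)"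
  "models \<sigma> \<nu> (Iff \<phi> \<psi>) \<longleftrightarrow> (models \<sigma> \<nu> \<phi> \<longleftrightarrow> models \<sigma> \<nu> \<psi>)"
  "models \<sigma> \<nu> (Leq a b) \<longleftrightarrow> leval \<sigma> a \<le> leval \<sigma> b"
  "models \<sigma> \<nu> (Equal a b) \<longleftrightarrow> leval \<sigma> a = leval \<sigma> b"
  by (auto simp: Imp_def Iff_def Leq_def Equal_def)

lemma models_unfold [simp]: "models \<sigma>' \<nu> (unfold \<sigma> \<phi>) = models \<sigma> \<nu> \<phi>"
proof (induction \<phi> arbitrary: \<sigma>)
  case (Iter c i a b \<phi>)
  then show ?case by (cases c) (simp_all add: image_iff del: fun_upd_apply)
qed simp_all

lemma models_inst:
  assumes "fv \<phi> \<subseteq> {n}"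
  shows "models \<sigma>' \<nu> (inst n \<kappa> \<phi>) = models (\<sigma>(n := \<kappa>)) \<nu> \<phi>"
  unfolding inst_def models_unfold using assms by (intro models_cong) auto

lemma models_join [simp]:
  "models \<sigma> \<nu> (join_of c \<phi> \<psi>) \<longleftrightarrow>
    (case c of BigOr \<Rightarrow> models \<sigma> \<nu> \<phi> \<or> models \<sigma> \<nu> \<psi> | BigAnd \<Rightarrow> models \<sigma> \<nu> \<phi> \<and> models \<sigma> \<nu> \<psi>)"
  by (cases c) auto

text \<open>\<open>c = BigAnd\<close> is the truth value of the unit of \<open>c\<close>; this lets
  the primed and unprimed rules share one statement.\<close>

lemma models_unit [simp]: "models \<sigma> \<nu> (unit_of c) \<longleftrightarrow> c = BigAnd"
  by (cases c) auto

lemma models_base_lit [simp]: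
  "models \<sigma> \<nu> (base_lit c \<phi>) \<longleftrightarrow> (models \<sigma> \<nu> \<phi> \<longleftrightarrow> c = BigAnd)"
  by (cases c) auto

lemma fv_derived [simp]:
  "fv (join_of c \<phi> \<psi>) = fv \<phi> \<union> fv \<psi>" "fv (unit_of c) = {}" "fv (base_lit c \<phi>) = fv \<phi>"
  "fv (Imp \<phi> \<psi>) = fv \<phi> \<union> fv \<psi>" "fv (Iff \<phi> \<psi>) = fv \<phi> \<union> fv \<psi>"
  "fv (Leq a b) = lvars a \<union> lvars b" "fv (Equal a b) = lvars a \<union> lvars b"
  by (cases c; auto simp: Imp_def Iff_def Leq_def Equal_def)+

text \<open>Equality of the free variables is proved along with equivalence because
  \<open>satisfiable\<close> restricts the sign of exactly these variables.\<close>

lemma alpha_sound: "alpha \<phi> \<psi> \<Longrightarrow> fv \<phi> = fv \<psi> \<and> (\<forall>\<sigma> \<nu>. models \<sigma> \<nu> \<phi> = models \<sigma> \<nu> \<psi>)"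
proof (induction rule: alpha.induct)
  case (alpha_rename j \<phi> c i a b)
  have "models \<sigma> \<nu> (Iter c j a b (subst i (mon 1 j) \<phi>)) = models \<sigma> \<nu> (Iter c i a b \<phi>)" for \<sigma> \<nu>
  proof (rule models_Iter_reindex[where f = id])
    fix k
    show "models (\<sigma>(j := k)) \<nu> (subst i (mon 1 j) \<phi>) = models (\<sigma>(i := id k)) \<nu> \<phi>"
      using alpha_rename by (subst models_subst) (auto intro!: models_cong)
  qed simp
  moreover have "fv (Iter c j a b (subst i (mon 1 j) \<phi>)) = fv (Iter c i a b \<phi>)"
    using fv_subst_rename[OF alpha_rename] by simp
  ultimately show ?case by simp
next
  case (alpha_Iter \<phi> \<phi>' c i a b)
  then show ?case by (cases c) (simp_all del: fun_upd_apply)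
qed auto

text \<open>A rule may introduce or lose the parameter. Demanding a nonnegative value of
  \<open>n\<close> in either case makes both sides of a step comparable.\<close>

lemma satisfiable_iff:
  assumes "fv \<phi> \<subseteq> {n}"
  shows "satisfiable \<phi> \<longleftrightarrow> (\<exists>\<sigma> \<nu>. 0 \<le> \<sigma> n \<and> models \<sigma> \<nu> \<phi>)"
proof
  assume "satisfiable \<phi>"
  then obtain \<sigma> \<nu> where *: "\<forall>v\<in>fv \<phi>. 0 \<le> \<sigma> v" "models \<sigma> \<nu> \<phi>" by (auto simp: satisfiable_def)
  show "\<exists>\<sigma> \<nu>. 0 \<le> \<sigma> n \<and> models \<sigma> \<nu> \<phi>"
  proof (cases "n \<in> fv \<phi>")
    case False
    \<comment> \<open>The given value of \<open>n\<close> may be negative here, but it has no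
      influence on the truth of the schema.\<close>
    then have "models (\<sigma>(n := 0)) \<nu> \<phi>"
      using * by (subst models_cong[of \<phi> _ \<sigma> _ \<nu>]) auto
    then show ?thesis by (intro exI[of _ "\<sigma>(n := 0)"]) auto
  qed (use * in auto)
qed (use assms in \<open>auto simp: satisfiable_def\<close>)

section \<open>Evaluation contexts\<close>

text \<open>\<open>reach \<phi> \<sigma> \<chi> \<tau>\<close>: evaluating \<open>\<phi>\<close> in \<open>\<sigma>\<close> leads to evaluating an occurrence of \<open>\<chi>\<close> in
  \<open>\<tau>\<close>. Replacing \<open>\<chi>\<close> is sound as soon as both sides agree at these \<open>\<tau>\<close> only.\<close>

inductive reach :: "schema \<Rightarrow> (avar \<Rightarrow> int) \<Rightarrow> schema \<Rightarrow> (avar \<Rightarrow> int) \<Rightarrow> bool"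
  for \<phi> :: schema and \<sigma> :: "avar \<Rightarrow> int" where
  reach_refl: "reach \<phi> \<sigma> \<phi> \<sigma>"
| reach_Neg: "reach \<phi> \<sigma> (Neg \<psi>) \<tau> \<Longrightarrow> reach \<phi> \<sigma> \<psi> \<tau>"
| reach_Or1: "reach \<phi> \<sigma> (Or \<psi> \<chi>) \<tau> \<Longrightarrow> reach \<phi> \<sigma> \<psi> \<tau>"
| reach_Or2: "reach \<phi> \<sigma> (Or \<psi> \<chi>) \<tau> \<Longrightarrow> reach \<phi> \<sigma> \<chi> \<tau>"
| reach_And1: "reach \<phi> \<sigma> (And \<psi> \<chi>) \<tau> \<Longrightarrow> reach \<phi> \<sigma> \<psi> \<tau>"
| reach_And2: "reach \<phi> \<sigma> (And \<psi> \<chi>) \<tau> \<Longrightarrow> reach \<phi> \<sigma> \<chi> \<tau>"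
| reach_Iter: "reach \<phi> \<sigma> (Iter c i a b \<psi>) \<tau> \<Longrightarrow> k \<in> {leval \<tau> a..leval \<tau> b} \<Longrightarrow>
    reach \<phi> \<sigma> \<psi> (\<tau>(i := k))"

lemma reach_subs: "reach \<phi> \<sigma> \<chi> \<tau> \<Longrightarrow> \<chi> \<in> subs \<phi>"
  by (induction rule: reach.induct) (auto intro: subs_trans[rotated])

text \<open>Assignments change only on entering an iteration, and only at its variable. In
  particular the parameter has one value throughout an evaluation.\<close>

lemma reach_unbound: "reach \<phi> \<sigma> \<chi> \<tau> \<Longrightarrow> v \<notin> bv \<phi> \<Longrightarrow> \<tau> v = \<sigma> v"
proof (induction rule: reach.induct)
  case (reach_Iter c i a b \<psi> \<tau> k)
  then have "i \<in> bv \<phi>" using bv_subs[OF reach_subs[OF reach_Iter.hyps(1)]] by simp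
  with reach_Iter show ?case by auto
qed auto

lemma models_repl:
  assumes "\<And>\<tau>. reach \<phi> \<sigma> y \<tau> \<Longrightarrow> models \<tau> \<nu> x = models \<tau> \<nu> y"
  shows "models \<sigma> \<nu> (repl y x \<phi>) = models \<sigma> \<nu> \<phi>"
proof -
  \<comment> \<open>The root \<open>\<phi>\<close>, \<open>\<sigma>\<close> stays fixed while
    \<open>\<chi>\<close> descends, so that the assumption on reached occurrences of
    \<open>y\<close> remains applicable below binders.\<close>
  have "models \<tau> \<nu> (repl y x \<chi>) = models \<tau> \<nu> \<chi>" if "reach \<phi> \<sigma> \<chi> \<tau>" for \<chi> \<tau>
    using that
  proof (induction \<chi> arbitrary: \<tau>)
    case (Neg \<chi>)
    have "models \<tau> \<nu> (repl y x \<chi>) = models \<tau> \<nu> \<chi>"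
      by (rule Neg.IH[OF reach_Neg[OF Neg.prems]])
    with Neg.prems assms show ?case by auto
  next
    case (Or \<chi>1 \<chi>2)
    have "models \<tau> \<nu> (repl y x \<chi>1) = models \<tau> \<nu> \<chi>1" "models \<tau> \<nu> (repl y x \<chi>2) = models \<tau> \<nu> \<chi>2"
      by (rule Or.IH(1)[OF reach_Or1[OF Or.prems]], rule Or.IH(2)[OF reach_Or2[OF Or.prems]])
    with Or.prems assms show ?case by auto
  next
    case (And \<chi>1 \<chi>2)
    have "models \<tau> \<nu> (repl y x \<chi>1) = models \<tau> \<nu> \<chi>1" "models \<tau> \<nu> (repl y x \<chi>2) = models \<tau> \<nu> \<chi>2"
      by (rule And.IH(1)[OF reach_And1[OF And.prems]], rule And.IH(2)[OF reach_And2[OF And.prems]])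
    with And.prems assms show ?case by auto
  next
    case (Iter c i a b \<chi>)
    have "models (\<tau>(i := k)) \<nu> (repl y x \<chi>) = models (\<tau>(i := k)) \<nu> \<chi>"
      if "k \<in> {leval \<tau> a..leval \<tau> b}" for k
      by (rule Iter.IH[OF reach_Iter[OF Iter.prems that]])
    then have "models \<tau> \<nu> (Iter c i a b (repl y x \<chi>)) = models \<tau> \<nu> (Iter c i a b \<chi>)"
      by (intro models_Iter_reindex[where f = id]) auto
    with Iter.prems assms show ?case by auto
  qed (use assms in auto)
  then show ?thesis by (simp add: reach_refl)
qed

section \<open>Extremal expressions bound the values taken by bound variables\<close>

lemma lvars_lin_ext:
  "(\<And>v. v \<in> lvars a \<Longrightarrow> lvars (f v) \<subseteq> A \<and> lvars (g v) \<subseteq> A) \<Longrightarrow> lvars (lin_ext f g a) \<subseteq> A"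
proof -
  assume *: "\<And>v. v \<in> lvars a \<Longrightarrow> lvars (f v) \<subseteq> A \<and> lvars (g v) \<subseteq> A"
  have "lvars (smul (coef a v) (if coef a v > 0 then f v else g v)) \<subseteq> A" if "v \<in> lvars a" for v
    using *[OF that] by (auto simp: lvars_def)
  then show ?thesis
    unfolding lin_ext_def
    by (intro order.trans[OF lvars_add] Un_least order.trans[OF lvars_sum] UN_least) auto
qed

lemma leval_lin_ext:
  "leval \<sigma> (lin_ext f g a) = Poly_Mapping.lookup a None +
    (\<Sum>v\<in>lvars a. coef a v * (if coef a v > 0 then leval \<sigma> (f v) else leval \<sigma> (g v)))"
  by (simp add: lin_ext_def if_distrib cong: if_cong)

text \<open>Each summand is bounded separately: a positive coefficient is paired with the lower
  bound of its variable, a negative one with the upper bound. The bounds are read in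
  \<open>\<sigma>\<close>, outside all binders, and \<open>a\<close> in \<open>\<tau>\<close>, at
  the place reached.\<close>

lemma lin_ext_lower:
  assumes "\<And>v. v \<in> lvars a \<Longrightarrow> leval \<sigma> (f v) \<le> \<tau> v \<and> \<tau> v \<le> leval \<sigma> (g v)"
  shows "leval \<sigma> (lin_ext f g a) \<le> leval \<tau> a"
  unfolding leval_lin_ext leval_lvars[of \<tau> a] using assms
  by (intro add_left_mono sum_mono) (auto intro: mult_left_mono mult_left_mono_neg)

lemma lin_ext_upper:
  assumes "\<And>v. v \<in> lvars a \<Longrightarrow> leval \<sigma> (f v) \<le> \<tau> v \<and> \<tau> v \<le> leval \<sigma> (g v)"
  shows "leval \<tau> a \<le> leval \<sigma> (lin_ext g f a)"
  unfolding leval_lin_ext leval_lvars[of \<tau> a] using assms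
  by (intro add_left_mono sum_mono) (auto intro: mult_left_mono mult_left_mono_neg)

text \<open>Extremal expressions mention free variables only, so they make sense as bounds of the
  new outermost iterations in \<open>tau3\<close> and \<open>tau4\<close>. The two implications are
  joined because the predicates are defined by mutual induction.\<close>

lemma vmin_vmax_lvars:
  "(vmin \<phi> v e \<longrightarrow> lvars e \<subseteq> fv \<phi>) \<and> (vmax \<phi> v' e' \<longrightarrow> lvars e' \<subseteq> fv \<phi>)"
  by (induction rule: vmin_vmax.induct) (auto intro!: lvars_lin_ext del: subsetI)

text \<open>Induction along the path. When an iteration over \<open>i\<close> is entered, its bounds
  mention variables whose values are already confined by the induction hypothesis, and the value of
  \<open>i\<close> lies between those bounds.\<close>

lemma reach_range:
  assumes "well_named n \<phi>" "reach \<phi> \<sigma> \<chi> \<tau>" "v \<in> fv \<chi>"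
  shows "(\<forall>e. vmin \<phi> v e \<longrightarrow> leval \<sigma> e \<le> \<tau> v) \<and> (\<forall>e. vmax \<phi> v e \<longrightarrow> \<tau> v \<le> leval \<sigma> e)"
  using assms(2,3)
proof (induction arbitrary: v rule: reach.induct)
  case reach_refl
  \<comment> \<open>At the root \<open>v\<close> is free and hence not bound, so its extremal
    expressions can only be \<open>v\<close> itself.\<close>
  have "v \<notin> bv \<phi>" using well_named_disjoint[OF assms(1)] reach_refl by auto
  then have "Iter c v a b \<psi> \<notin> subs \<phi>" for c a b \<psi> by (auto simp: bv_def)
  then show ?case by (auto elim: vmin.cases vmax.cases)
next
  case (reach_Iter c i a b \<psi> \<tau> k)
  show ?case
  proof (cases "v = i")
    case False
    then show ?thesis using reach_Iter.IH[of v] reach_Iter.prems by simp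
  next
    case True
    have sub: "Iter c i a b \<psi> \<in> subs \<phi>" using reach_Iter.hyps(1) by (rule reach_subs)
    then have "i \<in> bv \<phi>" unfolding bv_def by blast
    then have nf: "i \<notin> fv \<phi>" using well_named_disjoint[OF assms(1)] by auto
    have rng: "leval \<sigma> (lo w) \<le> \<tau> w \<and> \<tau> w \<le> leval \<sigma> (hi w)"
      if "vmin \<phi> w (lo w) \<and> vmax \<phi> w (hi w)" "w \<in> lvars a \<union> lvars b" for w lo hi
      using reach_Iter.IH[of w] that by auto
    have "leval \<sigma> e \<le> k" if "vmin \<phi> i e" for e
      using that
    proof cases
      case vmin_free
      with nf show ?thesis by simp
    next
      case (vmin_bound c' a' b' \<psi>' lo hi)
      \<comment> \<open>The iteration from which \<open>e\<close> was derived is the one being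
        entered, since there is only one over \<open>i\<close>.\<close>
      then have "a' = a" using well_named_unique[OF assms(1) sub] by blast
      with vmin_bound have "leval \<sigma> e \<le> leval \<tau> a"
        by (auto intro!: lin_ext_lower rng)
      with reach_Iter.hyps(2) show ?thesis by simp
    qed
    moreover have "k \<le> leval \<sigma> e" if "vmax \<phi> i e" for e
      using that
    proof cases
      case vmax_free
      with nf show ?thesis by simp
    next
      case (vmax_bound c' a' b' \<psi>' lo hi)
      then have "b' = b" using well_named_unique[OF assms(1) sub] by blast
      with vmax_bound have "leval \<tau> b \<le> leval \<sigma> e"
        by (auto intro!: lin_ext_upper rng)
      with reach_Iter.hyps(2) show ?thesis by simp
    qed
    ultimately show ?thesis using True by simp
  qed
qed auto

section \<open>Soundness of the rules\<close>

definition preserves :: "avar \<Rightarrow> (schema \<Rightarrow> schema \<Rightarrow> bool) \<Rightarrow> bool" where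
  "preserves n R \<longleftrightarrow> (\<forall>\<phi> \<phi>'. R \<phi> \<phi>' \<longrightarrow> well_named n \<phi> \<longrightarrow> fv \<phi> \<subseteq> {n} \<longrightarrow>
     fv \<phi>' \<subseteq> {n} \<and> (satisfiable \<phi>' \<longleftrightarrow> satisfiable \<phi>))"

text \<open>The assignment may change along with the valuation: the converse directions for
  \<open>tau6\<close> and \<open>tau7\<close> move \<open>n\<close> to another value.\<close>

lemma preservesI:
  assumes "\<And>\<phi> \<phi>'. R \<phi> \<phi>' \<Longrightarrow> well_named n \<phi> \<Longrightarrow> fv \<phi> \<subseteq> {n} \<Longrightarrow> fv \<phi>' \<subseteq> {n}"
    and "\<And>\<phi> \<phi>' \<sigma> \<nu>. R \<phi> \<phi>' \<Longrightarrow> well_named n \<phi> \<Longrightarrow> fv \<phi> \<subseteq> {n} \<Longrightarrow> 0 \<le> \<sigma> n \<Longrightarrow>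
      models \<sigma> \<nu> \<phi> \<Longrightarrow> \<exists>\<sigma> \<nu>. 0 \<le> \<sigma> n \<and> models \<sigma> \<nu> \<phi>'"
    and "\<And>\<phi> \<phi>' \<sigma> \<nu>. R \<phi> \<phi>' \<Longrightarrow> well_named n \<phi> \<Longrightarrow> fv \<phi> \<subseteq> {n} \<Longrightarrow> 0 \<le> \<sigma> n \<Longrightarrow>
      models \<sigma> \<nu> \<phi>' \<Longrightarrow> \<exists>\<sigma> \<nu>. 0 \<le> \<sigma> n \<and> models \<sigma> \<nu> \<phi>"
  shows "preserves n R"
  unfolding preserves_def
proof (intro allI impI conjI)
  fix \<phi> \<phi>' assume *: "R \<phi> \<phi>'" "well_named n \<phi>" "fv \<phi> \<subseteq> {n}"
  then show fv: "fv \<phi>' \<subseteq> {n}" by (rule assms(1))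
  show "satisfiable \<phi>' \<longleftrightarrow> satisfiable \<phi>"
    unfolding satisfiable_iff[OF fv] satisfiable_iff[OF *(3)]
    using assms(2,3)[OF *] by blast
qed

definition local_equiv :: "avar \<Rightarrow> schema \<Rightarrow> schema \<Rightarrow> bool" where
  "local_equiv n \<phi> \<phi>' \<longleftrightarrow>
     fv \<phi>' \<subseteq> insert n (fv \<phi>) \<and> (\<forall>\<sigma> \<nu>. models \<sigma> \<nu> \<phi>' = models \<sigma> \<nu> \<phi>)"

lemma local_equiv_at_iter:
  assumes "at_iter R G \<phi> \<phi>'" "well_named n \<phi>"
    and "\<And>G \<pi> \<pi>'. R G \<pi> \<pi>' \<Longrightarrow> well_named n \<pi> \<Longrightarrow> local_equiv n \<pi> \<pi>'"
  shows "local_equiv n \<phi> \<phi>'"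
  using assms(1,2)
proof (induction rule: at_iter.induct)
  case (1 G c i a b \<phi> \<phi>')
  then show ?case by (rule assms(3))
next
  case (7 c i a b \<phi> G \<phi>')
  then have IH: "local_equiv n \<phi> \<phi>'" by (blast dest: well_named_dests)
  then have "models \<sigma> \<nu> (Iter c i a b \<phi>') = models \<sigma> \<nu> (Iter c i a b \<phi>)" for \<sigma> \<nu>
    by (intro models_Iter_cong) (auto simp: local_equiv_def)
  with IH show ?case by (auto simp: local_equiv_def)
qed (force simp: local_equiv_def dest: well_named_dests)+

lemma preserves_at_iter:
  assumes "\<And>G \<pi> \<pi>'. R G \<pi> \<pi>' \<Longrightarrow> well_named n \<pi> \<Longrightarrow> local_equiv n \<pi> \<pi>'"
  shows "preserves n (at_iter R G)"
proof -
  have *: "local_equiv n \<phi> \<phi>'" if "at_iter R G \<phi> \<phi>'" "well_named n \<phi>" for \<phi> \<phi>'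
    using that by (rule local_equiv_at_iter) (rule assms)
  show ?thesis
    unfolding preserves_def
  proof (intro allI impI conjI)
    fix \<phi> \<phi>' assume "at_iter R G \<phi> \<phi>'" "well_named n \<phi>" and fv: "fv \<phi> \<subseteq> {n}"
    then have "local_equiv n \<phi> \<phi>'" by (intro *)
    with fv show fv': "fv \<phi>' \<subseteq> {n}" and "satisfiable \<phi>' \<longleftrightarrow> satisfiable \<phi>"
      using satisfiable_iff[OF fv] satisfiable_iff[of \<phi>' n] by (auto simp: local_equiv_def)
  qed
qed

text \<open>A Shannon expansion: the variables of \<open>e\<close> are free in the iteration and
  thus not rebound inside it, so the atom has one truth value during the whole evaluation of the
  iteration.\<close>

lemma preserves_tau1: "preserves n tau1"
  unfolding tau1_def
proof (rule preserves_at_iter)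
  fix G \<pi> \<pi>' assume "tau1_local G \<pi> \<pi>'" and wn: "well_named n \<pi>"
  then show "local_equiv n \<pi> \<pi>'"
  proof cases
    case (1 p e \<phi> c i a b)
    have unb: "lvars e \<inter> bv \<pi> = {}" using 1 well_named_disjoint[OF wn] by auto
    \<comment> \<open>\<open>\<chi>\<close> will be whichever of \<open>Top\<close> and
      \<open>Bot\<close> has the truth value of the atom in \<open>\<sigma>\<close>.\<close>
    have "models \<sigma> \<nu> (Iter c i a b (repl (Atom p e) \<chi> \<phi>)) = models \<sigma> \<nu> \<pi>"
      if "\<And>\<tau>. models \<tau> \<nu> \<chi> = models \<sigma> \<nu> (Atom p e)" for \<sigma> \<nu> \<chi>
      unfolding 1
    proof (rule models_Iter_cong)
      fix k
      show "models (\<sigma>(i := k)) \<nu> (repl (Atom p e) \<chi> \<phi>) = models (\<sigma>(i := k)) \<nu> \<phi>"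
      proof (rule models_repl)
        fix \<tau> assume "reach \<phi> (\<sigma>(i := k)) (Atom p e) \<tau>"
        then have "\<tau> v = \<sigma> v" if "v \<in> lvars e" for v
          using reach_unbound[of \<phi> "\<sigma>(i := k)" "Atom p e" \<tau> v] unb that 1
            by (auto simp: disjoint_iff)
        then show "models \<tau> \<nu> \<chi> = models \<tau> \<nu> (Atom p e)"
          using that leval_cong[of e \<tau> \<sigma>] by simp
      qed
    qed simp_all
    from this[of _ Top] this[of _ Bot]
    have "models \<sigma> \<nu> \<pi>' = models \<sigma> \<nu> \<pi>" for \<sigma> \<nu>
      unfolding 1 by (cases "\<nu> p (leval \<sigma> e)") simp_all
    moreover have "fv \<pi>' \<subseteq> insert n (fv \<pi>)"
      using fv_repl[of Top n "Atom p e" \<phi>] fv_repl[of Bot n "Atom p e" \<phi>] well_named_bv[OF wn] 1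
      by auto
    ultimately show ?thesis by (simp add: local_equiv_def)
  qed
qed

lemma preserves_tau2: "preserves n (tau2 n)"
proof (rule preservesI)
  fix \<phi> \<phi>' assume "tau2 n \<phi> \<phi>'" and wn: "well_named n \<phi>" and fv: "fv \<phi> \<subseteq> {n}"
  then show "fv \<phi>' \<subseteq> {n}"
  proof cases
    case (1 \<pi> c i a b \<chi> p k)
    then show ?thesis
      using fv_repl[of "Atom p (cst k)" n \<pi> \<phi>] well_named_bv[OF wn] fv by auto
  qed
next
  fix \<phi> \<phi>' \<nu> and \<sigma> :: "avar \<Rightarrow> int"
  assume "tau2 n \<phi> \<phi>'" and wn: "well_named n \<phi>" and fv: "fv \<phi> \<subseteq> {n}" and "0 \<le> \<sigma> n"
  then have n: "n \<notin> bv \<phi>" by (simp add: well_named_bv)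
  \<comment> \<open>Stated for every valuation: one direction uses it for \<open>\<nu>\<close>
    itself, the other for \<open>\<nu>\<close> with \<open>p\<close> redefined.\<close>
  have *: "models \<sigma> \<mu> \<phi>' \<longleftrightarrow> models \<sigma> \<mu> \<phi> \<and> \<mu> p k = models \<sigma> \<mu> \<pi>"
    if "fv \<pi> \<subseteq> {n}" "\<phi>' = And (Iff (Atom p (cst k)) \<pi>) (repl \<pi> (Atom p (cst k)) \<phi>)" for \<mu> p k \<pi>
  proof -
    have "models \<sigma> \<mu> (repl \<pi> (Atom p (cst k)) \<phi>) = models \<sigma> \<mu> \<phi>" if "\<mu> p k = models \<sigma> \<mu> \<pi>"
    proof (rule models_repl)
      fix \<tau> assume "reach \<phi> \<sigma> \<pi> \<tau>"
      then have "\<tau> n = \<sigma> n" using n by (rule reach_unbound)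
      then have "models \<tau> \<mu> \<pi> = models \<sigma> \<mu> \<pi>"
        using \<open>fv \<pi> \<subseteq> {n}\<close> by (intro models_cong) auto
      with that show "models \<tau> \<mu> (Atom p (cst k)) = models \<tau> \<mu> \<pi>" by simp
    qed
    with that show ?thesis by auto
  qed
  from \<open>tau2 n \<phi> \<phi>'\<close> show "\<exists>\<sigma> \<nu>. 0 \<le> \<sigma> n \<and> models \<sigma> \<nu> \<phi>" if "models \<sigma> \<nu> \<phi>'"
  proof cases
    case (1 \<pi> c i a b \<chi> p k)
    then show ?thesis using *[OF 1(4) 1(1), of \<nu>] that \<open>0 \<le> \<sigma> n\<close> by blast
  qed
  from \<open>tau2 n \<phi> \<phi>'\<close> show "\<exists>\<sigma> \<nu>. 0 \<le> \<sigma> n \<and> models \<sigma> \<nu> \<phi>'" if m: "models \<sigma> \<nu> \<phi>"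
  proof cases
    case (1 \<pi> c i a b \<chi> p k)
    \<comment> \<open>Only index \<open>k\<close> of \<open>p\<close> is read, so a constant
      function will do.\<close>
    let ?\<mu> = "\<nu>(p := \<lambda>_. models \<sigma> \<nu> \<pi>)"
    have p: "p \<notin> psyms \<phi>" using 1 by (simp add: fresh_def)
    moreover have "psyms \<pi> \<subseteq> psyms \<phi>"
      using 1 by (intro psyms_subs inside_iter_subs)
    ultimately have "models \<sigma> ?\<mu> \<phi> = models \<sigma> \<nu> \<phi>" "models \<sigma> ?\<mu> \<pi> = models \<sigma> \<nu> \<pi>"
      by (auto intro!: models_cong)
    then have "models \<sigma> ?\<mu> \<phi>'" using *[OF 1(4) 1(1), of ?\<mu>] m by simp
    with \<open>0 \<le> \<sigma> n\<close> show ?thesis by blast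
  qed
qed


section \<open>Tabulation of an iteration whose upper bound depends on a bound variable\<close>

text \<open>The common situation of \<open>\<tau>\<^sub>3\<close> (\<open>s = 1\<close>) and \<open>\<tau>\<^sub>4\<close> (\<open>s = - 1\<close>).\<close>

locale tabulation =
  fixes n :: avar and \<phi> :: schema and c :: iconn and i :: avar and a b t :: lexp
    and j :: avar and s :: int and \<psi> :: schema and p :: psym and lo hi :: lexp
    and \<pi> :: schema
  assumes pi_def: "\<pi> = Iter c i a t \<psi>"
    and leval_t: "\<And>\<sigma>. leval \<sigma> t = leval \<sigma> b + s * \<sigma> j"
    and lvars_t: "lvars t = insert j (lvars b)"
    and wn: "well_named n \<phi>" and fv_phi: "fv \<phi> \<subseteq> {n}"
    and inside: "inside_iter \<pi> \<phi>" and j: "j \<in> bv \<phi>"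
    and lvars_a: "lvars a \<subseteq> {n}" and lvars_b: "lvars b \<subseteq> {n}" and fv_psi: "fv \<psi> \<subseteq> {n, i}"
    and fresh: "fresh p \<phi>" and lo: "vmin \<phi> j lo" and hi: "vmax \<phi> j hi"
begin

text \<open>A constant upper bound detaches the iteration from \<open>j\<close>: the value of
  \<open>\<pi>\<close> at \<open>j = k\<close> is a single entry of this function, and the
  recurrence can be stated in the upper end \<open>m\<close>.\<close>

definition span :: "(avar \<Rightarrow> int) \<Rightarrow> (psym \<Rightarrow> int \<Rightarrow> bool) \<Rightarrow> int \<Rightarrow> bool" where
  "span \<sigma> \<nu> m \<longleftrightarrow> models \<sigma> \<nu> (Iter c i a (cst m) \<psi>)"

lemma pi_subs: "\<pi> \<in> subs \<phi>"
  using inside by (rule inside_iter_subs)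

lemma n_unbound: "n \<notin> bv \<phi>"
  using wn by (rule well_named_bv)

lemma n_neq: "n \<noteq> i" "n \<noteq> j"
  using bv_subs[OF pi_subs] n_unbound j by (auto simp: pi_def)

lemma pi_disjoint: "fv \<pi> \<inter> bv \<pi> = {}"
  using well_named_disjoint[OF well_named_subs[OF wn pi_subs]] .

text \<open>\<open>j\<close> occurs in the upper bound of \<open>\<pi>\<close>, so it is free there
  and cannot be bound inside; since \<open>\<psi>\<close> has no free variables but \<open>n\<close>
  and \<open>i\<close>, its truth does not depend on \<open>j\<close>.\<close>

lemma j_props: "j \<in> fv \<pi>" "j \<noteq> i" "j \<notin> bv \<psi>" "j \<notin> fv \<psi>" "n \<notin> bv \<psi>"
proof -
  show "j \<in> fv \<pi>" by (simp add: pi_def lvars_t)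
  with pi_disjoint show "j \<noteq> i" "j \<notin> bv \<psi>" by (auto simp: pi_def)
  with fv_psi n_neq show "j \<notin> fv \<psi>" by auto
  show "n \<notin> bv \<psi>" using n_unbound bv_subs[OF pi_subs] by (auto simp: pi_def)
qed

lemma j_bounds: "j \<notin> lvars a" "j \<notin> lvars b" "j \<notin> lvars lo" "j \<notin> lvars hi"
  using lvars_a lvars_b n_neq fv_phi vmin_vmax_lvars[of \<phi> j lo j hi] lo hi by auto

lemma lvars_lo_hi: "lvars lo \<subseteq> {n}" "lvars hi \<subseteq> {n}"
  using fv_phi vmin_vmax_lvars[of \<phi> j lo j hi] lo hi by auto

lemma p_notin: "p \<notin> psyms \<phi>" "p \<notin> psyms \<psi>"
proof -
  show "p \<notin> psyms \<phi>" using fresh by (simp add: fresh_def)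
  moreover have "\<psi> \<in> subs \<phi>" using pi_subs by (rule subs_trans[rotated]) (simp add: pi_def)
  ultimately show "p \<notin> psyms \<psi>" using psyms_subs by blast
qed

lemma models_body: "models (\<sigma>(j := k, i := x)) \<nu> \<psi> = models (\<sigma>(i := x)) \<nu> \<psi>"
  using j_props by (intro models_cong) auto

lemma models_pi: "models (\<sigma>(j := k)) \<nu> \<pi> = span \<sigma> \<nu> (leval \<sigma> b + s * k)"
  unfolding span_def pi_def
  by (rule models_Iter_cong) (simp_all add: leval_t j_bounds models_body del: fun_upd_apply, simp)

lemma models_subst_body:
  assumes "lvars u \<subseteq> {n, j}"
  shows "models (\<sigma>(j := k)) \<nu> (subst i u \<psi>) = models (\<sigma>(i := leval (\<sigma>(j := k)) u)) \<nu> \<psi>"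
  using assms j_props by (subst models_subst) (auto simp: models_body simp del: fun_upd_apply)

lemma span_empty: "m < leval \<sigma> a \<Longrightarrow> span \<sigma> \<nu> m \<longleftrightarrow> c = BigAnd"
  unfolding span_def by (cases c) simp_all

lemma span_step:
  assumes "leval \<sigma> a \<le> m"
  shows "span \<sigma> \<nu> m \<longleftrightarrow> (case c of
    BigOr \<Rightarrow> span \<sigma> \<nu> (m - 1) \<or> models (\<sigma>(i := m)) \<nu> \<psi> |
    BigAnd \<Rightarrow> span \<sigma> \<nu> (m - 1) \<and> models (\<sigma>(i := m)) \<nu> \<psi>)"
proof -
  have "{leval \<sigma> a..m} = insert m {leval \<sigma> a..m - 1}" using assms by auto
  then show ?thesis unfolding span_def by (cases c) (auto simp del: fun_upd_apply)
qed

text \<open>The recurrence has one solution, found upward from the empty range ending just below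
  \<open>a\<close>. The limit \<open>h\<close> is there because the rules assert the recurrence only
  between the extremal expressions of \<open>j\<close>.\<close>

lemma span_unique:
  assumes "f (leval \<sigma> a - 1) \<longleftrightarrow> c = BigAnd"
    and "\<And>m. leval \<sigma> a \<le> m \<Longrightarrow> m \<le> h \<Longrightarrow> f m \<longleftrightarrow> (case c of
      BigOr \<Rightarrow> f (m - 1) \<or> models (\<sigma>(i := m)) \<nu> \<psi> |
      BigAnd \<Rightarrow> f (m - 1) \<and> models (\<sigma>(i := m)) \<nu> \<psi>)"
    and "leval \<sigma> a - 1 \<le> m" "m \<le> h"
  shows "f m \<longleftrightarrow> span \<sigma> \<nu> m"
  using assms(3,4)
proof (induction m rule: int_ge_induct)
  case base
  show ?case using assms(1) by (simp add: span_empty)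
next
  case (step m)
  then have "f m \<longleftrightarrow> span \<sigma> \<nu> m" by simp
  with assms(2)[of "m + 1"] span_step[of \<sigma> "m + 1" \<nu>] step show ?case
    by (simp split: iconn.splits del: fun_upd_apply)
qed

text \<open>The table need only be right between \<open>lo\<close> and \<open>hi\<close>, since
  \<open>reach_range\<close> confines the value of \<open>j\<close> wherever \<open>\<pi>\<close> is
  evaluated.\<close>

lemma models_repl_pi:
  assumes "\<And>k. leval \<sigma> lo \<le> k \<Longrightarrow> k \<le> leval \<sigma> hi \<Longrightarrow> \<nu> p k = span \<sigma> \<nu> (leval \<sigma> b + s * k)"
  shows "models \<sigma> \<nu> (repl \<pi> (Atom p (mon 1 j)) \<phi>) = models \<sigma> \<nu> \<phi>"
proof (rule models_repl)
  fix \<tau> assume \<tau>: "reach \<phi> \<sigma> \<pi> \<tau>"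
  then have "\<tau> n = \<sigma> n" using n_unbound by (rule reach_unbound)
  moreover have "fv \<pi> \<subseteq> {n, j}"
    using lvars_a lvars_b fv_psi by (auto simp: pi_def lvars_t)
  ultimately have "models \<tau> \<nu> \<pi> = models (\<sigma>(j := \<tau> j)) \<nu> \<pi>"
    by (intro models_cong) auto
  also have "\<dots> = \<nu> p (\<tau> j)"
    using reach_range[OF wn \<tau> j_props(1)] lo hi by (simp add: models_pi assms)
  finally show "models \<tau> \<nu> (Atom p (mon 1 j)) = models \<tau> \<nu> \<pi>" by simp
qed

lemma tabulate:
  assumes "models \<sigma> \<nu> \<phi>"
  obtains \<mu> where "\<And>k. \<mu> p k = span \<sigma> \<mu> (leval \<sigma> b + s * k)"
    "models \<sigma> \<mu> (repl \<pi> (Atom p (mon 1 j)) \<phi>)"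
proof
  let ?\<mu> = "\<nu>(p := \<lambda>k. span \<sigma> \<nu> (leval \<sigma> b + s * k))"
  \<comment> \<open>There is no circularity: \<open>p\<close> does not occur in
    \<open>\<psi>\<close>, so a table computed from the old valuation is also right for the new
    one.\<close>
  have "span \<sigma> ?\<mu> m = span \<sigma> \<nu> m" for m
    unfolding span_def using p_notin by (intro models_cong) auto
  then show *: "?\<mu> p k = span \<sigma> ?\<mu> (leval \<sigma> b + s * k)" for k by simp
  have "models \<sigma> ?\<mu> \<phi>" using assms p_notin by (subst models_cong[of \<phi> _ \<sigma> _ \<nu>]) auto
  then show "models \<sigma> ?\<mu> (repl \<pi> (Atom p (mon 1 j)) \<phi>)" using * by (subst models_repl_pi)
qed

lemma fv_tabulated: "fv (repl \<pi> (Atom p (mon 1 j)) \<phi>) \<subseteq> {n}"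
  using fv_repl[of "Atom p (mon 1 j)" n \<pi> \<phi>] n_unbound j_props(1) fv_phi by auto

lemma fv_subst_body: "lvars u \<subseteq> {n, j} \<Longrightarrow> fv (subst i u \<psi>) \<subseteq> {n, j}"
  using fv_subst[of i u \<psi>] fv_psi by auto

end

text \<open>The entry of \<open>p\<close> at \<open>k\<close> stands for the iteration up to
  \<open>b + k\<close>. With \<open>m = b + k\<close> the added conjuncts become the start value and
  the recurrence of \<open>span_unique\<close>.\<close>

lemma preserves_tau3: "preserves n (tau3 n c)"
proof (rule preservesI)
  fix \<phi> \<phi>' assume "tau3 n c \<phi> \<phi>'" and wn: "well_named n \<phi>" and fv: "fv \<phi> \<subseteq> {n}"
  then show "fv \<phi>' \<subseteq> {n}"
  proof cases
    case (1 \<pi> i a b j \<psi> p lo hi)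
    have "n \<noteq> j" using 1 well_named_bv[OF wn] by auto
    then have t: "lvars (b + mon 1 j) = insert j (lvars b)"
      using \<open>lvars b \<subseteq> {n}\<close> by (subst lvars_disjoint_Un) auto
    interpret tabulation n \<phi> c i a b "b + mon 1 j" j 1 \<psi> p lo hi \<pi>
      by unfold_locales (use 1 wn fv t in simp_all)
    have "fv (subst i (b + mon 1 j) \<psi>) \<subseteq> {n, j}"
      using lvars_b by (intro fv_subst_body) (auto simp: t)
    moreover have "lvars (a - b) \<subseteq> {n}" "lvars (a - b - cst 1) \<subseteq> {n}" "lvars (mon 1 j - cst 1) \<subseteq> {j}"
      using lvars_a lvars_b lvars_diff[of a b] lvars_diff[of "a - b" "cst 1"]
        lvars_diff[of "mon 1 j" "cst 1"] by auto
    ultimately show ?thesis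
      unfolding 1(1) using fv_tabulated lvars_lo_hi
      by (intro order.trans[OF fv_chain] UN_least) auto
  qed
next
  fix \<phi> \<phi>' \<nu> and \<sigma> :: "avar \<Rightarrow> int"
  assume R: "tau3 n c \<phi> \<phi>'" and wn: "well_named n \<phi>" and fv: "fv \<phi> \<subseteq> {n}" and n0: "0 \<le> \<sigma> n"
  from R have "(models \<sigma> \<nu> \<phi> \<longrightarrow> (\<exists>\<nu>. models \<sigma> \<nu> \<phi>')) \<and> (models \<sigma> \<nu> \<phi>' \<longrightarrow> models \<sigma> \<nu> \<phi>)"
  proof cases
    case (1 \<pi> i a b j \<psi> p lo hi)
    have "n \<noteq> j" using 1 well_named_bv[OF wn] by auto
    then have t: "lvars (b + mon 1 j) = insert j (lvars b)"
      using \<open>lvars b \<subseteq> {n}\<close> by (subst lvars_disjoint_Un) auto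
    interpret tabulation n \<phi> c i a b "b + mon 1 j" j 1 \<psi> p lo hi \<pi>
      by unfold_locales (use 1 wn fv t in simp_all)
    let ?A = "leval \<sigma> a" and ?B = "leval \<sigma> b"
    have R: "models (\<sigma>(j := k)) \<nu> (subst i (b + mon 1 j) \<psi>) = models (\<sigma>(i := ?B + k)) \<nu> \<psi>" for k \<nu>
      using lvars_b by (subst models_subst_body) (auto simp: t j_bounds)
    have eq: "models \<sigma> \<nu> \<phi>' \<longleftrightarrow>
        (\<nu> p (?A - ?B - 1) \<longleftrightarrow> c = BigAnd) \<and>
        (\<forall>k\<in>{leval \<sigma> lo..?A - ?B - 1}. \<nu> p k \<longleftrightarrow> c = BigAnd) \<and>
        (\<forall>k\<in>{?A - ?B..leval \<sigma> hi}. \<nu> p k \<longleftrightarrow> (case c of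
          BigOr \<Rightarrow> \<nu> p (k - 1) \<or> models (\<sigma>(i := ?B + k)) \<nu> \<psi> |
          BigAnd \<Rightarrow> \<nu> p (k - 1) \<and> models (\<sigma>(i := ?B + k)) \<nu> \<psi>)) \<and>
        models \<sigma> \<nu> (repl \<pi> (Atom p (mon 1 j)) \<phi>)" for \<nu>
      unfolding 1(1) by (cases c) (simp_all add: R del: fun_upd_apply, simp_all)
    show ?thesis
    proof (intro conjI impI)
      assume "models \<sigma> \<nu> \<phi>"
      then obtain \<mu> where \<mu>: "\<And>k. \<mu> p k = span \<sigma> \<mu> (?B + 1 * k)"
        "models \<sigma> \<mu> (repl \<pi> (Atom p (mon 1 j)) \<phi>)" by (rule tabulate) blast
      then have "models \<sigma> \<mu> \<phi>'"
        unfolding eq using span_empty[of _ \<sigma> \<mu>] span_step[of \<sigma> _ \<mu>]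
        by (auto simp: algebra_simps simp del: fun_upd_apply split: iconn.splits)
      then show "\<exists>\<nu>. models \<sigma> \<nu> \<phi>'" by blast
    next
      assume m: "models \<sigma> \<nu> \<phi>'"
      have "\<nu> p k = span \<sigma> \<nu> (?B + 1 * k)" if "leval \<sigma> lo \<le> k" "k \<le> leval \<sigma> hi" for k
      proof (cases "k < ?A - ?B")
        case True
        then show ?thesis using m that unfolding eq by (simp add: span_empty)
      next
        case False
        have "\<nu> p (?B + k - ?B) \<longleftrightarrow> span \<sigma> \<nu> (?B + k)"
        proof (rule span_unique[where f = "\<lambda>m. \<nu> p (m - ?B)" and h = "?B + leval \<sigma> hi"])
          \<comment> \<open>The iterated literals may miss this index, namely when \<open>lo\<close>
            exceeds it; the start value comes from the separate first conjunct.\<close>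
          have "?A - 1 - ?B = ?A - ?B - 1" by simp
          then show "\<nu> p (?A - 1 - ?B) \<longleftrightarrow> c = BigAnd" using m unfolding eq by metis
        next
          fix m assume "?A \<le> m" "m \<le> ?B + leval \<sigma> hi"
          then have "m - ?B \<in> {?A - ?B..leval \<sigma> hi}" by auto
          with m have "\<nu> p (m - ?B) \<longleftrightarrow> (case c of
              BigOr \<Rightarrow> \<nu> p (m - ?B - 1) \<or> models (\<sigma>(i := ?B + (m - ?B))) \<nu> \<psi> |
              BigAnd \<Rightarrow> \<nu> p (m - ?B - 1) \<and> models (\<sigma>(i := ?B + (m - ?B))) \<nu> \<psi>)"
            unfolding eq by blast
          moreover have "m - ?B - 1 = m - 1 - ?B" "?B + (m - ?B) = m" by simp_all
          ultimately show "\<nu> p (m - ?B) \<longleftrightarrow> (case c of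
              BigOr \<Rightarrow> \<nu> p (m - 1 - ?B) \<or> models (\<sigma>(i := m)) \<nu> \<psi> |
              BigAnd \<Rightarrow> \<nu> p (m - 1 - ?B) \<and> models (\<sigma>(i := m)) \<nu> \<psi>)"
            by (simp only:)
        qed (use False that in auto)
        then show ?thesis by simp
      qed
      from models_repl_pi[OF this] m show "models \<sigma> \<nu> \<phi>" by (simp add: eq)
    qed
  qed
  with n0 show "models \<sigma> \<nu> \<phi> \<Longrightarrow> \<exists>\<sigma> \<nu>. 0 \<le> \<sigma> n \<and> models \<sigma> \<nu> \<phi>'"
    "models \<sigma> \<nu> \<phi>' \<Longrightarrow> \<exists>\<sigma> \<nu>. 0 \<le> \<sigma> n \<and> models \<sigma> \<nu> \<phi>" by blast+
qed

text \<open>The bound \<open>b - j\<close> falls as \<open>j\<close> grows, so the recurrence runs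
  downward from \<open>b - a + 1\<close>. Reading the table at \<open>b - m\<close> makes it run
  upward in \<open>m\<close>, and the minimum of \<open>j\<close> becomes the upper limit
  \<open>b - lo\<close>.\<close>

lemma preserves_tau4: "preserves n (tau4 n c)"
proof (rule preservesI)
  fix \<phi> \<phi>' assume "tau4 n c \<phi> \<phi>'" and wn: "well_named n \<phi>" and fv: "fv \<phi> \<subseteq> {n}"
  then show "fv \<phi>' \<subseteq> {n}"
  proof cases
    case (1 \<pi> i a b j \<psi> p lo hi)
    have "n \<noteq> j" using 1 well_named_bv[OF wn] by auto
    then have t: "lvars (b - mon 1 j) = insert j (lvars b)"
      using \<open>lvars b \<subseteq> {n}\<close> by (subst lvars_disjoint_Un) auto
    interpret tabulation n \<phi> c i a b "b - mon 1 j" j "- 1" \<psi> p lo hi \<pi>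
      by unfold_locales (use 1 wn fv t in simp_all)
    have "fv (subst i (b - mon 1 j) \<psi>) \<subseteq> {n, j}"
      using lvars_b by (intro fv_subst_body) (auto simp: t)
    moreover have "lvars (b - a) \<subseteq> {n}" "lvars (b - a + cst 1) \<subseteq> {n}" "lvars (mon 1 j + cst 1) \<subseteq> {j}"
      using lvars_a lvars_b lvars_diff[of b a] lvars_add[of "b - a" "cst 1"]
        lvars_add[of "mon 1 j" "cst 1"] by auto
    ultimately show ?thesis
      unfolding 1(1) using fv_tabulated lvars_lo_hi
      by (intro order.trans[OF fv_chain] UN_least) auto
  qed
next
  fix \<phi> \<phi>' \<nu> and \<sigma> :: "avar \<Rightarrow> int"
  assume R: "tau4 n c \<phi> \<phi>'" and wn: "well_named n \<phi>" and fv: "fv \<phi> \<subseteq> {n}" and n0: "0 \<le> \<sigma> n"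
  from R have "(models \<sigma> \<nu> \<phi> \<longrightarrow> (\<exists>\<nu>. models \<sigma> \<nu> \<phi>')) \<and> (models \<sigma> \<nu> \<phi>' \<longrightarrow> models \<sigma> \<nu> \<phi>)"
  proof cases
    case (1 \<pi> i a b j \<psi> p lo hi)
    have "n \<noteq> j" using 1 well_named_bv[OF wn] by auto
    then have t: "lvars (b - mon 1 j) = insert j (lvars b)"
      using \<open>lvars b \<subseteq> {n}\<close> by (subst lvars_disjoint_Un) auto
    interpret tabulation n \<phi> c i a b "b - mon 1 j" j "- 1" \<psi> p lo hi \<pi>
      by unfold_locales (use 1 wn fv t in simp_all)
    let ?A = "leval \<sigma> a" and ?B = "leval \<sigma> b"
    have R: "models (\<sigma>(j := k)) \<nu> (subst i (b - mon 1 j) \<psi>) = models (\<sigma>(i := ?B - k)) \<nu> \<psi>" for k \<nu>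
      using lvars_b by (subst models_subst_body) (auto simp: t j_bounds)
    have eq: "models \<sigma> \<nu> \<phi>' \<longleftrightarrow>
        (\<nu> p (?B - ?A + 1) \<longleftrightarrow> c = BigAnd) \<and>
        (\<forall>k\<in>{?B - ?A + 1..leval \<sigma> hi}. \<nu> p k \<longleftrightarrow> c = BigAnd) \<and>
        (\<forall>k\<in>{leval \<sigma> lo..?B - ?A}. \<nu> p k \<longleftrightarrow> (case c of
          BigOr \<Rightarrow> \<nu> p (k + 1) \<or> models (\<sigma>(i := ?B - k)) \<nu> \<psi> |
          BigAnd \<Rightarrow> \<nu> p (k + 1) \<and> models (\<sigma>(i := ?B - k)) \<nu> \<psi>)) \<and>
        models \<sigma> \<nu> (repl \<pi> (Atom p (mon 1 j)) \<phi>)" for \<nu>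
      unfolding 1(1) by (cases c) (simp_all add: R del: fun_upd_apply, simp_all)
    show ?thesis
    proof (intro conjI impI)
      assume "models \<sigma> \<nu> \<phi>"
      then obtain \<mu> where \<mu>: "\<And>k. \<mu> p k = span \<sigma> \<mu> (?B + - 1 * k)"
        "models \<sigma> \<mu> (repl \<pi> (Atom p (mon 1 j)) \<phi>)" by (rule tabulate) blast
      then have "models \<sigma> \<mu> \<phi>'"
        unfolding eq using span_empty[of _ \<sigma> \<mu>] span_step[of \<sigma> _ \<mu>]
        by (auto simp: algebra_simps simp del: fun_upd_apply split: iconn.splits)
      then show "\<exists>\<nu>. models \<sigma> \<nu> \<phi>'" by blast
    next
      assume m: "models \<sigma> \<nu> \<phi>'"
      have "\<nu> p k = span \<sigma> \<nu> (?B + - 1 * k)" if "leval \<sigma> lo \<le> k" "k \<le> leval \<sigma> hi" for k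
      proof (cases "?B - ?A < k")
        case True
        then show ?thesis using m that unfolding eq by (simp add: span_empty)
      next
        case False
        have "\<nu> p (?B - (?B - k)) \<longleftrightarrow> span \<sigma> \<nu> (?B - k)"
        proof (rule span_unique[where f = "\<lambda>m. \<nu> p (?B - m)" and h = "?B - leval \<sigma> lo"])
          have "?B - (?A - 1) = ?B - ?A + 1" by simp
          then show "\<nu> p (?B - (?A - 1)) \<longleftrightarrow> c = BigAnd" using m unfolding eq by metis
        next
          fix m assume "?A \<le> m" "m \<le> ?B - leval \<sigma> lo"
          then have "?B - m \<in> {leval \<sigma> lo..?B - ?A}" by auto
          with m have "\<nu> p (?B - m) \<longleftrightarrow> (case c of
              BigOr \<Rightarrow> \<nu> p (?B - m + 1) \<or> models (\<sigma>(i := ?B - (?B - m))) \<nu> \<psi> |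
              BigAnd \<Rightarrow> \<nu> p (?B - m + 1) \<and> models (\<sigma>(i := ?B - (?B - m))) \<nu> \<psi>)"
            unfolding eq by blast
          moreover have "?B - m + 1 = ?B - (m - 1)" "?B - (?B - m) = m" by simp_all
          ultimately show "\<nu> p (?B - m) \<longleftrightarrow> (case c of
              BigOr \<Rightarrow> \<nu> p (?B - (m - 1)) \<or> models (\<sigma>(i := m)) \<nu> \<psi> |
              BigAnd \<Rightarrow> \<nu> p (?B - (m - 1)) \<and> models (\<sigma>(i := m)) \<nu> \<psi>)"
            by (simp only:)
        qed (use False that in auto)
        then show ?thesis by simp
      qed
      from models_repl_pi[OF this] m show "models \<sigma> \<nu> \<phi>" by (simp add: eq)
    qed
  qed
  with n0 show "models \<sigma> \<nu> \<phi> \<Longrightarrow> \<exists>\<sigma> \<nu>. 0 \<le> \<sigma> n \<and> models \<sigma> \<nu> \<phi>'"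
    "models \<sigma> \<nu> \<phi>' \<Longrightarrow> \<exists>\<sigma> \<nu>. 0 \<le> \<sigma> n \<and> models \<sigma> \<nu> \<phi>" by blast+
qed


section \<open>Shifting, reflecting and splitting iteration ranges\<close>

lemma leval_shift_image:
  assumes "\<And>k. f k = k + d"
  shows "f ` {l..u :: int} = {l + d..u + d}"
proof -
  have "f = (\<lambda>k. k + d)" using assms by auto
  then show ?thesis by (simp only: image_add_atLeastAtMost')
qed

text \<open>A change of the iteration variable. \<open>t\<close> may contain \<open>i\<close> and is
  regarded as the function sending each new value of \<open>i\<close> to the old one.\<close>

lemma models_Iter_subst:
  assumes "lvars t \<inter> bv \<phi> = {}"
    and "(\<lambda>k. leval (\<sigma>(i := k)) t) ` {leval \<sigma> a'..leval \<sigma> b'} = {leval \<sigma> a..leval \<sigma> b}"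
  shows "models \<sigma> \<nu> (Iter c i a' b' (subst i t \<phi>)) = models \<sigma> \<nu> (Iter c i a b \<phi>)"
  using assms(1)
  by (intro models_Iter_reindex[OF assms(2)]) (simp add: models_subst del: fun_upd_apply)

lemma models_Iter_Un:
  assumes "{leval \<sigma> a..leval \<sigma> b} = {leval \<sigma> a1..leval \<sigma> b1} \<union> {leval \<sigma> a2..leval \<sigma> b2}"
  shows "models \<sigma> \<nu> (Iter c i a b \<phi>) =
    models \<sigma> \<nu> (join_of c (Iter c i a1 b1 \<phi>) (Iter c i a2 b2 \<phi>))"
proof -
  have "models \<sigma> \<nu> (Iter c i a b \<phi>) \<longleftrightarrow> (case c of
      BigOr \<Rightarrow> \<exists>k\<in>{leval \<sigma> a..leval \<sigma> b}. models (\<sigma>(i := k)) \<nu> \<phi>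
    | BigAnd \<Rightarrow> \<forall>k\<in>{leval \<sigma> a..leval \<sigma> b}. models (\<sigma>(i := k)) \<nu> \<phi>)"
    by (simp only: models.simps)
  then show ?thesis
    unfolding assms bex_Un ball_Un by (cases c) (simp_all del: fun_upd_apply)
qed

lemma local_equivI:
  "fv \<phi>' \<subseteq> insert n (fv \<phi>) \<Longrightarrow> (\<And>\<sigma> \<nu>. models \<sigma> \<nu> \<phi>' = models \<sigma> \<nu> \<phi>) \<Longrightarrow> local_equiv n \<phi> \<phi>'"
  by (simp add: local_equiv_def)

lemma lvars_leI: "(\<And>v. v \<notin> A \<Longrightarrow> coef e v = 0) \<Longrightarrow> lvars e \<subseteq> A"
  by (auto simp: lvars_def)

lemma preserves_tau5: "preserves n (tau5 n)"
  unfolding tau5_def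
proof (rule preserves_at_iter)
  fix \<pi> \<pi>' assume "tau5_local n \<pi> \<pi>'" and wn: "well_named n \<pi>"
  then show "local_equiv n \<pi> \<pi>'"
  proof cases
    case (1 \<alpha> c i \<beta> \<gamma> \<delta> \<phi>)
    have ni: "n \<noteq> i" "n \<notin> bv \<phi>" "i \<notin> bv \<phi>"
      using well_named_bv[OF wn] well_named_Iter_bv[of n c i] wn unfolding 1 by auto
    let ?t = "mon 1 i + mon \<alpha> n"
    have t: "lvars ?t \<subseteq> {n, i}" by (rule lvars_leI) auto
    have t': "lvars (mon (\<gamma> - \<alpha>) n - cst \<delta>) \<subseteq> {n}" by (rule lvars_leI) auto
    show ?thesis unfolding 1
    proof (rule local_equivI)
      show "fv (Iter c i (cst \<beta>) (mon (\<gamma> - \<alpha>) n - cst \<delta>) (subst i ?t \<phi>))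
        \<subseteq> insert n (fv (Iter c i (mon \<alpha> n + cst \<beta>) (mon \<gamma> n - cst \<delta>) \<phi>))"
        using fv_subst[of i ?t \<phi>] t t' by auto
      show "models \<sigma> \<nu> (Iter c i (cst \<beta>) (mon (\<gamma> - \<alpha>) n - cst \<delta>) (subst i ?t \<phi>))
        = models \<sigma> \<nu> (Iter c i (mon \<alpha> n + cst \<beta>) (mon \<gamma> n - cst \<delta>) \<phi>)" for \<sigma> \<nu>
      proof (rule models_Iter_subst)
        show "lvars ?t \<inter> bv \<phi> = {}" using t ni by auto
        show "(\<lambda>k. leval (\<sigma>(i := k)) ?t) ` {leval \<sigma> (cst \<beta>)..leval \<sigma> (mon (\<gamma> - \<alpha>) n - cst \<delta>)}
          = {leval \<sigma> (mon \<alpha> n + cst \<beta>)..leval \<sigma> (mon \<gamma> n - cst \<delta>)}"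
          using ni by (subst leval_shift_image[where d = "\<alpha> * \<sigma> n"]) (auto simp: algebra_simps)
      qed
    qed
  qed
qed

text \<open>As \<alpha> is negative, \<open>n > \<kappa>\<close> forces the upper bound below
  \<gamma>: the iteration is empty and equals its unit. Smaller values of \<open>n\<close> are
  covered by the instances, and a true instance for \<open>k\<close> is a model with
  \<open>n\<close> set to \<open>k\<close>.\<close>

lemma preserves_tau6: "preserves n (tau6 n)"
proof (rule preservesI)
  fix \<phi> \<phi>' assume "tau6 n \<phi> \<phi>'" and wn: "well_named n \<phi>" and fv: "fv \<phi> \<subseteq> {n}"
  then show "fv \<phi>' \<subseteq> {n}"
  proof cases
    case (1 \<pi> c i \<gamma> \<alpha> \<beta> \<chi> \<kappa>)
    then show ?thesis unfolding 1(1)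
      using fv_repl[of "unit_of c" n \<pi> \<phi>] well_named_bv[OF wn] fv
      by (intro order.trans[OF fv_chain] UN_least) (auto simp: inst_def fv_unfold)
  qed
next
  fix \<phi> \<phi>' \<nu> and \<sigma> :: "avar \<Rightarrow> int"
  assume R: "tau6 n \<phi> \<phi>'" and wn: "well_named n \<phi>" and fv: "fv \<phi> \<subseteq> {n}" and n0: "0 \<le> \<sigma> n"
  from R have "(models \<sigma> \<nu> \<phi> \<longrightarrow> models \<sigma> \<nu> \<phi>') \<and>
    (models \<sigma> \<nu> \<phi>' \<longrightarrow> (\<exists>\<sigma>. 0 \<le> \<sigma> n \<and> models \<sigma> \<nu> \<phi>))"
  proof cases
    case (1 \<pi> c i \<gamma> \<alpha> \<beta> \<chi> \<kappa>)
    have r: "models \<sigma> \<nu> (repl \<pi> (unit_of c) \<phi>) = models \<sigma> \<nu> \<phi>" if "\<kappa> < \<sigma> n"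
    proof (rule models_repl)
      fix \<tau> assume "reach \<phi> \<sigma> \<pi> \<tau>"
      then have \<tau>: "\<tau> n = \<sigma> n" using well_named_bv[OF wn] by (rule reach_unbound)
      have "real_of_int (\<gamma> + \<beta>) / real_of_int \<alpha> \<le> real_of_int \<kappa>"
        unfolding 1(5) by (rule le_of_int_ceiling)
      also have "\<dots> < real_of_int (\<sigma> n)" using that by simp
      \<comment> \<open>Multiplying by the negative \<alpha> reverses the inequality.\<close>
      finally have "real_of_int (\<sigma> n) * real_of_int \<alpha> < real_of_int (\<gamma> + \<beta>)"
        using \<open>\<alpha> < 0\<close> by (simp add: neg_divide_less_eq)
      then have "\<sigma> n * \<alpha> < \<gamma> + \<beta>"
        by (simp only: of_int_mult[symmetric] of_int_less_iff)
      then show "models \<tau> \<nu> (unit_of c) = models \<tau> \<nu> \<pi>"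
        using \<tau> unfolding 1(2) by (cases c) (simp_all add: algebra_simps)
    qed
    have eq: "models \<sigma> \<nu> \<phi>' \<longleftrightarrow>
        (\<exists>k\<in>{0..\<kappa>}. models (\<sigma>(n := k)) \<nu> \<phi>) \<or> \<kappa> < \<sigma> n \<and> models \<sigma> \<nu> \<phi>"
      unfolding 1(1) using r by (auto simp: models_inst[OF fv, of \<sigma> \<nu> _ \<sigma>] simp del: fun_upd_apply)
    show ?thesis
    proof (intro conjI impI)
      assume m: "models \<sigma> \<nu> \<phi>"
      then show "models \<sigma> \<nu> \<phi>'"
        unfolding eq using n0 by (cases "\<kappa> < \<sigma> n") (auto intro!: bexI[of _ "\<sigma> n"])
    next
      assume "models \<sigma> \<nu> \<phi>'"
      then show "\<exists>\<sigma>. 0 \<le> \<sigma> n \<and> models \<sigma> \<nu> \<phi>"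
        unfolding eq using n0 by (metis atLeastAtMost_iff fun_upd_same)
    qed
  qed
  with n0 show "models \<sigma> \<nu> \<phi> \<Longrightarrow> \<exists>\<sigma> \<nu>. 0 \<le> \<sigma> n \<and> models \<sigma> \<nu> \<phi>'"
    "models \<sigma> \<nu> \<phi>' \<Longrightarrow> \<exists>\<sigma> \<nu>. 0 \<le> \<sigma> n \<and> models \<sigma> \<nu> \<phi>" by blast+
qed

text \<open>The range is cut after \<open>(\<alpha> - 1) n - \<beta>\<close>; the remaining
  \<open>n\<close> values are shifted to \<open>1..n\<close>. If the cut point lies below \<gamma>,
  then \<open>n\<close> is at most \<kappa> and an instance takes over.\<close>

lemma preserves_tau7: "preserves n (tau7 n)"
proof (rule preservesI)
  fix \<phi> \<phi>' assume "tau7 n \<phi> \<phi>'" and wn: "well_named n \<phi>" and fv: "fv \<phi> \<subseteq> {n}"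
  then show "fv \<phi>' \<subseteq> {n}"
  proof cases
    case (1 \<pi> c i \<gamma> \<alpha> \<beta> \<chi> \<kappa> \<psi>')
    let ?t = "mon 1 i + mon (\<alpha> - 1) n - cst \<beta>"
    have "lvars (mon (\<alpha> - 1) n - cst \<beta>) \<subseteq> {n}" "lvars ?t \<subseteq> {n, i}"
      by (rule lvars_leI; auto)+
    with fv_subst[of i ?t \<chi>] have "fv \<psi>' \<subseteq> insert n (fv \<pi>)"
      unfolding 1(2) 1(6) by auto
    then have "fv (repl \<pi> \<psi>' \<phi>) \<subseteq> {n}"
      using fv_repl[of \<psi>' n \<pi> \<phi>] well_named_bv[OF wn] fv by auto
    with \<open>lvars (mon (\<alpha> - 1) n - cst \<beta>) \<subseteq> {n}\<close> show ?thesis unfolding 1(1)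
      by (intro order.trans[OF fv_chain] UN_least) (auto simp: inst_def fv_unfold)
  qed
next
  fix \<phi> \<phi>' \<nu> and \<sigma> :: "avar \<Rightarrow> int"
  assume R: "tau7 n \<phi> \<phi>'" and wn: "well_named n \<phi>" and fv: "fv \<phi> \<subseteq> {n}" and n0: "0 \<le> \<sigma> n"
  from R have "(models \<sigma> \<nu> \<phi> \<longrightarrow> models \<sigma> \<nu> \<phi>') \<and>
    (models \<sigma> \<nu> \<phi>' \<longrightarrow> (\<exists>\<sigma>. 0 \<le> \<sigma> n \<and> models \<sigma> \<nu> \<phi>))"
  proof cases
    case (1 \<pi> c i \<gamma> \<alpha> \<beta> \<chi> \<kappa> \<psi>')
    let ?t = "mon 1 i + mon (\<alpha> - 1) n - cst \<beta>"
    have wn\<pi>: "well_named n \<pi>" using wn 1(3) by (rule well_named_subs)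
    have ni: "n \<noteq> i" "n \<notin> bv \<chi>" "i \<notin> bv \<chi>"
      using well_named_bv[OF wn\<pi>] well_named_Iter_bv[of n c i] wn\<pi> unfolding 1(2) by auto
    \<comment> \<open>Without this condition the shifted part could contain values below \<gamma>.
      Together with \<open>0 \<le> \<sigma> n\<close> it makes the two parts cover exactly the old
      range.\<close>
    have r: "models \<sigma> \<nu> (repl \<pi> \<psi>' \<phi>) = models \<sigma> \<nu> \<phi>" if "\<gamma> \<le> (\<alpha> - 1) * \<sigma> n - \<beta>"
    proof (rule models_repl)
      fix \<tau> assume "reach \<phi> \<sigma> \<pi> \<tau>"
      then have \<tau>: "\<tau> n = \<sigma> n" using well_named_bv[OF wn] by (rule reach_unbound)
      let ?m = "(\<alpha> - 1) * \<sigma> n - \<beta>"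
      have "models \<tau> \<nu> (Iter c i (cst 1) (mon 1 n) (subst i ?t \<chi>)) =
        models \<tau> \<nu> (Iter c i (cst (?m + 1)) (cst (?m + \<sigma> n)) \<chi>)"
      proof (rule models_Iter_subst)
        have "lvars ?t \<subseteq> {n, i}" by (rule lvars_leI) auto
        then show "lvars ?t \<inter> bv \<chi> = {}" using ni by auto
        show "(\<lambda>k. leval (\<tau>(i := k)) ?t) ` {leval \<tau> (cst 1)..leval \<tau> (mon 1 n)}
          = {leval \<tau> (cst (?m + 1))..leval \<tau> (cst (?m + \<sigma> n))}"
          using ni \<tau> by (subst leval_shift_image[where d = ?m]) (auto simp: algebra_simps)
      qed
      moreover have "models \<tau> \<nu> \<pi> = models \<tau> \<nu> (join_of c (Iter c i (cst \<gamma>) (mon (\<alpha> - 1) n - cst \<beta>) \<chi>)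
          (Iter c i (cst (?m + 1)) (cst (?m + \<sigma> n)) \<chi>))"
        unfolding 1(2) using \<tau> n0 that by (intro models_Iter_Un) (auto simp: algebra_simps)
      ultimately show "models \<tau> \<nu> \<psi>' = models \<tau> \<nu> \<pi>"
        unfolding 1(6) by (simp only: models_join)
    qed
    have small: "\<sigma> n \<le> \<kappa>" if "\<not> \<gamma> \<le> (\<alpha> - 1) * \<sigma> n - \<beta>"
    proof -
      have "real_of_int (\<sigma> n * (\<alpha> - 1)) \<le> real_of_int (\<gamma> + \<beta>)"
        using that by (simp only: of_int_le_iff) (simp add: algebra_simps)
      then have "real_of_int (\<sigma> n) \<le> real_of_int (\<gamma> + \<beta>) / real_of_int (\<alpha> - 1)"
        using \<open>\<alpha> > 1\<close> by (simp add: pos_le_divide_eq)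
      then show ?thesis unfolding 1(5) by (simp only: le_floor_iff)
    qed
    have eq: "models \<sigma> \<nu> \<phi>' \<longleftrightarrow>
        \<gamma> \<le> (\<alpha> - 1) * \<sigma> n - \<beta> \<and> models \<sigma> \<nu> \<phi> \<or> (\<exists>k\<in>{0..\<kappa>}. models (\<sigma>(n := k)) \<nu> \<phi>)"
      unfolding 1(1) using r by (auto simp: models_inst[OF fv, of \<sigma> \<nu> _ \<sigma>] simp del: fun_upd_apply)
    show ?thesis
    proof (intro conjI impI)
      assume m: "models \<sigma> \<nu> \<phi>"
      show "models \<sigma> \<nu> \<phi>'"
      proof (cases "\<gamma> \<le> (\<alpha> - 1) * \<sigma> n - \<beta>")
        case True
        with m show ?thesis unfolding eq by blast
      next
        case False
        from small[OF this] m n0 have "\<sigma> n \<in> {0..\<kappa>}" "models (\<sigma>(n := \<sigma> n)) \<nu> \<phi>" by simp_all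
        then show ?thesis unfolding eq by blast
      qed
    next
      assume "models \<sigma> \<nu> \<phi>'"
      then show "\<exists>\<sigma>. 0 \<le> \<sigma> n \<and> models \<sigma> \<nu> \<phi>"
        unfolding eq using n0 by (metis atLeastAtMost_iff fun_upd_same)
    qed
  qed
  with n0 show "models \<sigma> \<nu> \<phi> \<Longrightarrow> \<exists>\<sigma> \<nu>. 0 \<le> \<sigma> n \<and> models \<sigma> \<nu> \<phi>'"
    "models \<sigma> \<nu> \<phi>' \<Longrightarrow> \<exists>\<sigma> \<nu>. 0 \<le> \<sigma> n \<and> models \<sigma> \<nu> \<phi>" by blast+
qed

lemma preserves_tau8: "preserves n (tau8 n)"
  unfolding tau8_def
proof (rule preserves_at_iter)
  fix \<pi> \<pi>' assume "tau8_local n \<pi> \<pi>'" and wn: "well_named n \<pi>"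
  then show "local_equiv n \<pi> \<pi>'"
  proof cases
    case (1 \<phi> c i \<gamma> \<beta>)
    have ni: "n \<noteq> i" "n \<notin> bv \<phi>" "i \<notin> bv \<phi>"
      using well_named_bv[OF wn] well_named_Iter_bv[of n c i] wn unfolding 1 by auto
    let ?t = "mon 1 n - mon 1 i"
    have t: "lvars ?t \<subseteq> {n, i}" by (rule lvars_leI) auto
    have t': "lvars (mon 1 n - cst \<delta>) \<subseteq> {n}" for \<delta> by (rule lvars_leI) auto
    show ?thesis unfolding 1(1,2)
    proof (rule local_equivI)
      show "fv (Iter c i (cst \<beta>) (mon 1 n - cst \<gamma>) (subst i ?t \<phi>))
        \<subseteq> insert n (fv (Iter c i (cst \<gamma>) (mon 1 n - cst \<beta>) \<phi>))"
        using fv_subst[of i ?t \<phi>] t t'[of \<gamma>] by auto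
      show "models \<sigma> \<nu> (Iter c i (cst \<beta>) (mon 1 n - cst \<gamma>) (subst i ?t \<phi>))
        = models \<sigma> \<nu> (Iter c i (cst \<gamma>) (mon 1 n - cst \<beta>) \<phi>)" for \<sigma> \<nu>
      proof (rule models_Iter_subst)
        show "lvars ?t \<inter> bv \<phi> = {}" using t ni by auto
        \<comment> \<open>Reflection at \<open>n\<close> exchanges the two ends of the range, which
          is why \<gamma> and \<beta> trade places.\<close>
        have "(\<lambda>k. leval (\<sigma>(i := k)) ?t) = (-) (\<sigma> n)" using ni by auto
        then show "(\<lambda>k. leval (\<sigma>(i := k)) ?t) ` {leval \<sigma> (cst \<beta>)..leval \<sigma> (mon 1 n - cst \<gamma>)}
          = {leval \<sigma> (cst \<gamma>)..leval \<sigma> (mon 1 n - cst \<beta>)}"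
          by (simp only: image_diff_atLeastAtMost) simp
      qed
    qed
  qed
qed

text \<open>If the range is nonempty, its last value \<open>n - \<beta>\<close> is split off and the
  rest is shifted so as to start at the common lower bound; otherwise only the unit remains.\<close>

lemma preserves_tau10: "preserves n (tau10 n)"
proof -
  have "preserves n (at_iter (\<lambda>_. tau10_local n \<alpha>' \<beta>') [])" for \<alpha>' \<beta>'
  proof (rule preserves_at_iter)
    fix \<pi> \<pi>' assume "tau10_local n \<alpha>' \<beta>' \<pi> \<pi>'" and wn: "well_named n \<pi>"
    then show "local_equiv n \<pi> \<pi>'"
    proof cases
      case (1 \<alpha> \<beta> c i \<phi>)
      have ni: "n \<noteq> i" "n \<notin> bv \<phi>" "i \<notin> bv \<phi>"
        using well_named_bv[OF wn] well_named_Iter_bv[of n c i] wn unfolding 1 by auto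
      let ?t = "mon 1 i - cst \<alpha>' + cst \<alpha>" and ?u = "mon 1 n - cst \<beta>"
      let ?v = "mon 1 n - cst \<beta> - cst 1 + cst \<alpha>' - cst \<alpha>"
      have lv: "lvars ?t \<subseteq> {i}" "lvars ?u \<subseteq> {n}" "lvars ?v \<subseteq> {n}"
        by (rule lvars_leI; auto)+
      show ?thesis
      proof (rule local_equivI)
        show "fv \<pi>' \<subseteq> insert n (fv \<pi>)"
          unfolding 1 using fv_subst[of i ?t \<phi>] fv_subst[of i ?u \<phi>] lv by auto
        fix \<sigma> \<nu>
        have t: "models \<sigma> \<nu> (Iter c i (cst \<alpha>') ?v (subst i ?t \<phi>))
          = models \<sigma> \<nu> (Iter c i (cst \<alpha>) (?u - cst 1) \<phi>)"
        proof (rule models_Iter_subst)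
          show "lvars ?t \<inter> bv \<phi> = {}" using lv ni by auto
          show "(\<lambda>k. leval (\<sigma>(i := k)) ?t) ` {leval \<sigma> (cst \<alpha>')..leval \<sigma> ?v}
            = {leval \<sigma> (cst \<alpha>)..leval \<sigma> (?u - cst 1)}"
            by (subst leval_shift_image[where d = "\<alpha> - \<alpha>'"]) auto
        qed
        \<comment> \<open>The single instance is written as an iteration over a one-element range,
          so that the splitting lemma applies.\<close>
        have u: "models \<sigma> \<nu> (subst i ?u \<phi>) = models \<sigma> \<nu> (Iter c i ?u ?u \<phi>)"
          using lv ni by (subst models_subst) (auto split: iconn.splits simp del: fun_upd_apply)
        show "models \<sigma> \<nu> \<pi>' = models \<sigma> \<nu> \<pi>"
        proof (cases "\<sigma> n < \<alpha> + \<beta>")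
          case True
          then show ?thesis unfolding 1 by (cases c) simp_all
        next
          case False
          then have "models \<sigma> \<nu> \<pi> =
            models \<sigma> \<nu> (join_of c (Iter c i (cst \<alpha>) (?u - cst 1) \<phi>) (Iter c i ?u ?u \<phi>))"
            unfolding 1(2) 1(1) by (intro models_Iter_Un) auto
          also have "\<dots> = models \<sigma> \<nu> (join_of c (Iter c i (cst \<alpha>') ?v (subst i ?t \<phi>)) (subst i ?u \<phi>))"
            by (simp only: models_join t u)
          also have "\<dots> = models \<sigma> \<nu> \<pi>'"
            unfolding 1(2) 1(1) using False by (simp del: models_join models.simps(8) add: models.simps(3,4,5,6,7))
          finally show ?thesis ..
        qed
      qed
    qed
  qed
  then show ?thesis unfolding preserves_def tau10_def by blast
qed

section \<open>Elimination of the parameter from indices\<close>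

lemma subs_chain: "\<phi> \<in> set \<phi>s \<Longrightarrow> subs \<phi> \<subseteq> subs (chain c \<phi>s)"
  by (induction c \<phi>s rule: chain.induct) (case_tac c; auto)+

lemma fv_overline: "overline n B \<phi> \<phi>' \<Longrightarrow> fv \<phi>' \<subseteq> insert n (fv \<phi>)"
proof (induction rule: overline.induct)
  case (4 a p \<alpha>)
  then show ?case by (auto simp: lvars_def)
next
  case (5 a p \<alpha>)
  then show ?case by (auto simp: lvars_def)
qed auto

text \<open>Agreement is required only at atoms of the unfolding, that is, at variables really
  consulted. This weak premise is what the relevant elements of \<open>Psi\<close> can supply. As
  \<open>n\<close> is not bound, the offset in each index stays the same below binders.\<close>

lemma models_overline:
  assumes "overline n B \<phi> \<phi>'" "n \<notin> bv \<phi>"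
    and "\<And>p \<alpha> m. Atom (BarPos p \<alpha>) (cst m) \<in> subs (unfold \<sigma> \<phi>') \<Longrightarrow>
      \<mu> (BarPos p \<alpha>) m = \<nu> p (2 * \<alpha> * \<sigma> n + m)"
    and "\<And>p \<alpha> m. Atom (BarNeg p \<alpha>) (cst m) \<in> subs (unfold \<sigma> \<phi>') \<Longrightarrow>
      \<mu> (BarNeg p \<alpha>) m = \<nu> p (2 * \<alpha> * \<sigma> n - m)"
  shows "models \<sigma> \<mu> \<phi>' = models \<sigma> \<nu> \<phi>"
  using assms
proof (induction arbitrary: \<sigma> rule: overline.induct)
  case (9 \<phi> \<phi>' c i a b)
  show ?case
  proof (rule models_Iter_cong)
    fix k assume k: "k \<in> {leval \<sigma> a..leval \<sigma> b}"
    have sub: "subs (unfold (\<sigma>(i := k)) \<phi>') \<subseteq> subs (unfold \<sigma> (Iter c i a b \<phi>'))"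
      unfolding unfold.simps using k by (intro subs_chain) auto
    have "n \<noteq> i" using 9 by auto
    then have n: "(\<sigma>(i := k)) n = \<sigma> n" by simp
    show "models (\<sigma>(i := k)) \<mu> \<phi>' = models (\<sigma>(i := k)) \<nu> \<phi>"
    proof (rule "9.IH"; (unfold n)?)
      show "n \<notin> bv \<phi>" using 9 by simp
      show "\<mu> (BarPos p \<alpha>) m = \<nu> p (2 * \<alpha> * \<sigma> n + m)"
        if "Atom (BarPos p \<alpha>) (cst m) \<in> subs (unfold (\<sigma>(i := k)) \<phi>')" for p \<alpha> m
        by (rule "9.prems"(2)[OF subsetD[OF sub that]])
      show "\<mu> (BarNeg p \<alpha>) m = \<nu> p (2 * \<alpha> * \<sigma> n - m)"
        if "Atom (BarNeg p \<alpha>) (cst m) \<in> subs (unfold (\<sigma>(i := k)) \<phi>')" for p \<alpha> m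
        by (rule "9.prems"(3)[OF subsetD[OF sub that]])
    qed
  qed simp_all
qed auto

lemma Psi_sound:
  assumes "\<theta> \<in> Psi n"
    and "\<And>p \<alpha> m. \<mu> (BarPos p \<alpha>) m = \<nu> p (2 * \<alpha> * \<sigma> n + m)"
    and "\<And>p \<alpha> m. \<mu> (BarNeg p \<alpha>) m = \<nu> p (2 * \<alpha> * \<sigma> n - m)"
  shows "models \<sigma> \<mu> \<theta>"
  using assms unfolding Psi_def by (auto simp: mult.assoc)

lemma fv_bv_Psi:
  assumes "\<theta> \<in> Psi n"
  shows "fv \<theta> \<subseteq> {n}" "bv \<theta> = {}"
proof -
  have 1: "x = n" if "a \<in> psi_arg n" "x \<in> lvars a" for a x
    using that by (auto simp: psi_arg_def lvars_def split: if_splits)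
  have 2: "x = n" if "a \<in> psi_arg n" "x \<in> lvars (mon k n + a) \<or> x \<in> lvars (mon k n - a)" for a k x
    using 1[OF that(1)] that(2) by (auto simp: lvars_def split: if_splits)
  show "fv \<theta> \<subseteq> {n}" using assms unfolding Psi_def by (auto dest: 1 2)
  show "bv \<theta> = {}" using assms unfolding Psi_def
    by (auto simp: Imp_def Iff_def Equal_def Leq_def)
qed

text \<open>Relevance asks for syntactic occurrence of instantiated atoms; by this equation an atom
  with constant index is its own instance.\<close>

lemma lsubst_cst [simp]: "lsubst v t (cst k) = cst k"
  by (rule poly_mapping_eqI) (simp add: lsubst_def coef_def[symmetric] lookup_add lookup_minus lookup_smul mon_def)

lemma cst_inject: "cst k = cst l \<longleftrightarrow> k = l"
  using leval_cst by metis

text \<open>Distinct atoms that occur in the instance and have coinciding meanings make the formula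
  relevant, so \<open>S\<close> holds an element equivalent to it at the current value of
  \<open>n\<close>. Identical atoms, which relevance leaves out, agree trivially.\<close>

lemma Psi_choice_use:
  assumes "Psi_choice n \<phi>' S" "\<And>\<theta>. \<theta> \<in> S \<Longrightarrow> models \<sigma> \<mu> \<theta>" "0 \<le> \<sigma> n"
    and "Imp (Equal x y) (Iff (Atom p (cst k)) (Atom q (cst l))) \<in> Psi n" (is "?\<theta> \<in> _")
    and "Atom p (cst k) \<in> subs (inst n (\<sigma> n) \<phi>')" "Atom q (cst l) \<in> subs (inst n (\<sigma> n) \<phi>')"
    and "\<And>\<tau>. \<tau> n = \<sigma> n \<Longrightarrow> leval \<tau> x = leval \<tau> y"
  shows "\<mu> p k = \<mu> q l"
proof (cases "p = q \<and> k = l")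
  case False
  \<comment> \<open>Relevance is witnessed by a natural number; nonnegativity of
    \<open>\<sigma> n\<close> makes the round trip harmless.\<close>
  let ?t = "cst (int (nat (\<sigma> n)))"
  have t: "leval \<tau> ?t = \<sigma> n" for \<tau> using assms(3) by simp
  have inst: "models \<tau> \<mu>' (subst n ?t \<chi>) = models (\<tau>(n := \<sigma> n)) \<mu>' \<chi>" if "bv \<chi> = {}" for \<tau> \<mu>' \<chi>
    using that by (simp only: models_subst t Int_empty_right)
  have "relevant_at n \<phi>' (nat (\<sigma> n)) ?\<theta>"
    unfolding relevant_at_def
  proof (intro exI conjI allI)
    show "Atom p (cst k) \<noteq> Atom q (cst l)" using False by (auto simp: cst_inject)
    have "bv (Equal x y) = {}" by (simp add: Equal_def Leq_def)
    then show "models \<tau> \<nu> (subst n ?t (Equal x y))" for \<tau> \<nu>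
      by (simp only: inst models_derived) (simp add: assms(7))
  qed (use assms(3,5,6) in simp_all)
  then obtain \<theta>' where \<theta>': "\<theta>' \<in> S" and
    eq: "\<And>\<tau> \<nu>. models \<tau> \<nu> (subst n ?t ?\<theta>) = models \<tau> \<nu> (subst n ?t \<theta>')"
    using assms(1)[unfolded Psi_choice_def, THEN conjunct2, THEN conjunct2, rule_format, OF assms(4)]
    by blast
  have "\<theta>' \<in> Psi n" using \<theta>' assms(1) by (auto simp: Psi_choice_def)
  then have "models \<sigma> \<mu> (subst n ?t \<theta>')"
    using assms(2)[OF \<theta>'] by (simp only: inst[OF fv_bv_Psi(2)] fun_upd_triv)
  then have "models \<sigma> \<mu> ?\<theta>"
    unfolding eq[symmetric] by (simp only: inst[OF fv_bv_Psi(2)[OF assms(4)]] fun_upd_triv)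
  with assms(7)[of \<sigma>] show ?thesis by simp
qed simp

text \<open>The propositional variable of the original schema that the barred variable \<open>q\<^sub>m\<close> stands for
  when the parameter has the value \<open>\<kappa>\<close>.\<close>

primrec unbar :: "int \<Rightarrow> psym \<Rightarrow> int \<Rightarrow> (psym \<times> int) option" where
  "unbar \<kappa> (Sym p) m = None"
| "unbar \<kappa> (BarPos p \<alpha>) m = Some (p, 2 * \<alpha> * \<kappa> + m)"
| "unbar \<kappa> (BarNeg p \<alpha>) m = Some (p, 2 * \<alpha> * \<kappa> - m)"

text \<open>One family of \<open>Psi\<close> serves each combination of signs; the combination of
  negative with positive is the mixed family read backwards.\<close>

lemma unbar_consistent:
  assumes S: "Psi_choice n \<phi>' S" "\<And>\<theta>. \<theta> \<in> S \<Longrightarrow> models \<sigma> \<mu> \<theta>" "0 \<le> \<sigma> n"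
    and T: "Atom q (cst m) \<in> subs (inst n (\<sigma> n) \<phi>')" "Atom q' (cst m') \<in> subs (inst n (\<sigma> n) \<phi>')"
    and u: "unbar (\<sigma> n) q m = Some u" "unbar (\<sigma> n) q' m' = Some u"
  shows "\<mu> q m = \<mu> q' m'"
proof -
  \<comment> \<open>After unfolding all indices are constants, so elements of \<open>Psi\<close>
    with constant arguments suffice here.\<close>
  have arg: "cst k \<in> psi_arg n" for k by (simp add: psi_arg_def)
  have pn: "\<mu> (BarPos p \<alpha>) k = \<mu> (BarNeg p \<beta>) l"
    if "2 * \<alpha> * \<sigma> n + k = 2 * \<beta> * \<sigma> n - l"
      "Atom (BarPos p \<alpha>) (cst k) \<in> subs (inst n (\<sigma> n) \<phi>')"
      "Atom (BarNeg p \<beta>) (cst l) \<in> subs (inst n (\<sigma> n) \<phi>')" for p \<alpha> k \<beta> l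
  proof (rule Psi_choice_use[OF S])
    show "Imp (Equal (mon (2 * \<alpha>) n + cst k) (mon (2 * \<beta>) n - cst l))
        (Iff (Atom (BarPos p \<alpha>) (cst k)) (Atom (BarNeg p \<beta>) (cst l))) \<in> Psi n"
      unfolding Psi_def by (rule UnI1, rule UnI1) (use arg in blast)
  qed (use that in simp_all)
  have pp: "\<mu> (BarPos p \<alpha>) k = \<mu> (BarPos p \<beta>) l"
    if "2 * \<alpha> * \<sigma> n + k = 2 * \<beta> * \<sigma> n + l"
      "Atom (BarPos p \<alpha>) (cst k) \<in> subs (inst n (\<sigma> n) \<phi>')"
      "Atom (BarPos p \<beta>) (cst l) \<in> subs (inst n (\<sigma> n) \<phi>')" for p \<alpha> k \<beta> l
  proof (rule Psi_choice_use[OF S])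
    show "Imp (Equal (mon (2 * \<alpha>) n + cst k) (mon (2 * \<beta>) n + cst l))
        (Iff (Atom (BarPos p \<alpha>) (cst k)) (Atom (BarPos p \<beta>) (cst l))) \<in> Psi n"
      unfolding Psi_def by (rule UnI1, rule UnI2) (use arg in blast)
  qed (use that in simp_all)
  have nn: "\<mu> (BarNeg p \<alpha>) k = \<mu> (BarNeg p \<beta>) l"
    if "2 * \<alpha> * \<sigma> n - k = 2 * \<beta> * \<sigma> n - l"
      "Atom (BarNeg p \<alpha>) (cst k) \<in> subs (inst n (\<sigma> n) \<phi>')"
      "Atom (BarNeg p \<beta>) (cst l) \<in> subs (inst n (\<sigma> n) \<phi>')" for p \<alpha> k \<beta> l
  proof (rule Psi_choice_use[OF S])
    show "Imp (Equal (mon (2 * \<alpha>) n - cst k) (mon (2 * \<beta>) n - cst l))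
        (Iff (Atom (BarNeg p \<alpha>) (cst k)) (Atom (BarNeg p \<beta>) (cst l))) \<in> Psi n"
      unfolding Psi_def by (rule UnI2) (use arg in blast)
  qed (use that in simp_all)
  show ?thesis
  proof (cases q)
    case q: (BarPos p \<alpha>)
    show ?thesis
    proof (cases q')
      case (BarPos p' \<beta>)
      with pp[of \<alpha> m \<beta> m' p] q T u show ?thesis by auto
    next
      case (BarNeg p' \<beta>)
      with pn[of \<alpha> m \<beta> m' p] q T u show ?thesis by auto
    qed (use u in simp)
  next
    case q: (BarNeg p \<alpha>)
    show ?thesis
    proof (cases q')
      case (BarPos p' \<beta>)
      with pn[of \<beta> m' \<alpha> m p] q T u show ?thesis by auto
    next
      case (BarNeg p' \<beta>)
      with nn[of \<alpha> m \<beta> m' p] q T u show ?thesis by auto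
    qed (use u in simp)
  qed (use u in simp)
qed

lemma preserves_tau9: "preserves n (tau9 n)"
proof (rule preservesI)
  fix \<phi> \<phi>' assume "tau9 n \<phi> \<phi>'" and fv: "fv \<phi> \<subseteq> {n}"
  then show "fv \<phi>' \<subseteq> {n}"
  proof cases
    case (1 p \<chi> \<theta>s)
    have "set \<theta>s \<subseteq> Psi n" using 1 by (simp add: Psi_choice_def)
    then have "fv (chain BigAnd \<theta>s) \<subseteq> {n}"
      using fv_bv_Psi(1) by (intro order.trans[OF fv_chain] UN_least) blast
    with fv_overline[OF 1(4)] fv show ?thesis unfolding 1(1) by auto
  qed
next
  fix \<phi> \<phi>' \<nu> and \<sigma> :: "avar \<Rightarrow> int"
  assume R: "tau9 n \<phi> \<phi>'" and wn: "well_named n \<phi>" and "fv \<phi> \<subseteq> {n}"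
    and n0: "0 \<le> \<sigma> n" and m: "models \<sigma> \<nu> \<phi>"
  from R show "\<exists>\<sigma> \<nu>. 0 \<le> \<sigma> n \<and> models \<sigma> \<nu> \<phi>'"
  proof cases
    case (1 p \<chi> \<theta>s)
    \<comment> \<open>Each barred variable copies the original variable it stands for. The default
      concerns only \<open>Sym\<close> symbols, which occur neither in the overlined schema nor in
      \<open>Psi\<close>.\<close>
    define \<mu> where "\<mu> q k = (case unbar (\<sigma> n) q k of None \<Rightarrow> False | Some (p, x) \<Rightarrow> \<nu> p x)" for q k
    have "models \<sigma> \<mu> \<chi> = models \<sigma> \<nu> \<phi>"
      by (rule models_overline[OF 1(4) well_named_bv[OF wn]]) (simp_all add: \<mu>_def)
    moreover have "models \<sigma> \<mu> \<theta>" if "\<theta> \<in> set \<theta>s" for \<theta>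
      using that 1(5) by (intro Psi_sound[of \<theta> n \<mu> \<nu>]) (auto simp: Psi_choice_def \<mu>_def)
    ultimately show ?thesis using n0 m unfolding 1(1) by auto
  qed
next
  fix \<phi> \<phi>' \<mu> and \<sigma> :: "avar \<Rightarrow> int"
  assume R: "tau9 n \<phi> \<phi>'" and wn: "well_named n \<phi>" and fv: "fv \<phi> \<subseteq> {n}"
    and n0: "0 \<le> \<sigma> n" and m: "models \<sigma> \<mu> \<phi>'"
  from R show "\<exists>\<sigma> \<nu>. 0 \<le> \<sigma> n \<and> models \<sigma> \<nu> \<phi>"
  proof cases
    case (1 p \<chi> \<theta>s)
    \<comment> \<open>\<open>?\<sigma>\<close> is the assignment from the definition of
      \<open>inst\<close>, so unfolding \<chi> in it gives literally the instance whose atoms are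
      collected in \<open>?T\<close>.\<close>
    let ?T = "subs (inst n (\<sigma> n) \<chi>)" and ?\<sigma> = "(\<lambda>_. 0)(n := \<sigma> n)"
    \<comment> \<open>An original variable is true if some barred representative in the instance is
      true; consistency makes all its representatives agree. Variables without a representative
      become false.\<close>
    define \<nu> where "\<nu> p x \<longleftrightarrow>
      (\<exists>q k. Atom q (cst k) \<in> ?T \<and> unbar (\<sigma> n) q k = Some (p, x) \<and> \<mu> q k)" for p x
    have S: "models \<sigma> \<mu> \<theta>" if "\<theta> \<in> set \<theta>s" for \<theta> using m that unfolding 1(1) by simp
    have \<nu>: "\<mu> q k = \<nu> p x" if "Atom q (cst k) \<in> ?T" "unbar (\<sigma> n) q k = Some (p, x)" for q k p x
      using unbar_consistent[OF 1(5) S n0 that(1) _ that(2)] that unfolding \<nu>_def by blast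
    have "models ?\<sigma> \<mu> \<chi> = models ?\<sigma> \<nu> \<phi>"
      by (rule models_overline[OF 1(4) well_named_bv[OF wn]]) (auto intro!: \<nu> simp: inst_def)
    moreover have "models ?\<sigma> \<mu> \<chi>"
      using m fv_overline[OF 1(4)] fv unfolding 1(1) by (subst models_cong[of \<chi> _ \<sigma> _ \<mu>]) auto
    ultimately show ?thesis using n0 by (intro exI[of _ ?\<sigma>] exI[of _ \<nu>]) simp
  qed
qed


section \<open>Rewrite sequences\<close>

lemma preserves_mod_alpha:
  assumes "preserves n R" "mod_alpha n R \<phi> \<phi>'" "fv \<phi> \<subseteq> {n}"
  shows "fv \<phi>' \<subseteq> {n} \<and> (satisfiable \<phi>' \<longleftrightarrow> satisfiable \<phi>)"
proof -
  obtain \<psi> \<psi>' where *: "alpha \<phi> \<psi>" "well_named n \<psi>" "R \<psi> \<psi>'" "alpha \<psi>' \<phi>'"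
    using assms(2) by (auto simp: mod_alpha_def)
  have "satisfiable \<phi> = satisfiable \<psi>" "satisfiable \<psi>' = satisfiable \<phi>'"
    using alpha_sound[OF *(1)] alpha_sound[OF *(4)] by (simp_all add: satisfiable_def)
  moreover have "fv \<psi> \<subseteq> {n}" using alpha_sound[OF *(1)] assms(3) by simp
  then have "fv \<psi>' \<subseteq> {n} \<and> (satisfiable \<psi>' \<longleftrightarrow> satisfiable \<psi>)"
    using assms(1) *(2,3) unfolding preserves_def by blast
  ultimately show ?thesis using alpha_sound[OF *(4)] by simp
qed

lemma tau_preserves:
  assumes "tau n \<phi> \<phi>'" "fv \<phi> \<subseteq> {n}"
  shows "fv \<phi>' \<subseteq> {n} \<and> (satisfiable \<phi>' \<longleftrightarrow> satisfiable \<phi>)"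
proof -
  let ?rules = "[tau1, tau2 n, tau3 n BigOr, tau3 n BigAnd, tau4 n BigOr, tau4 n BigAnd,
      tau5 n, tau6 n, tau7 n, tau8 n, tau9 n, tau10 n]"
  obtain T where "T \<in> set (tau_rules n)" "T \<phi> \<phi>'"
    using assms(1) unfolding tau_def by (meson nth_mem)
  then obtain R where R: "R \<in> set ?rules" "mod_alpha n R \<phi> \<phi>'"
    unfolding tau_rules_def set_map by blast
  have "preserves n R'" if "R' \<in> set ?rules" for R'
    using that preserves_tau1 preserves_tau2 preserves_tau3 preserves_tau4 preserves_tau5
      preserves_tau6 preserves_tau7 preserves_tau8 preserves_tau9 preserves_tau10 by auto
  from this[OF R(1)] R(2)
  show ?thesis using assms(2) by (rule preserves_mod_alpha)
qed

theorem theorem4p12: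
  fixes n :: avar and \<phi> \<psi> :: schema
  assumes "bound_linear n \<phi>" and "normalized n \<phi>"
    and "psyms \<phi> \<subseteq> range Sym"
    and "tau_normal_form n \<phi> \<psi>"
  shows "satisfiable \<phi> \<longleftrightarrow> satisfiable \<psi>"
proof -
  have "(tau n)\<^sup>*\<^sup>* \<phi> \<psi>" using assms(4) by (simp add: tau_normal_form_def)
  then have "fv \<psi> \<subseteq> {n} \<and> (satisfiable \<psi> \<longleftrightarrow> satisfiable \<phi>)"
  proof induction
    case base
    show ?case using assms(1) by (simp add: bound_linear_def)
  next
    case (step \<chi> \<psi>)
    then show ?case using tau_preserves[of n \<chi> \<psi>] by simp
  qed
  then show ?thesis by simp
qed

end
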